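(* Let $\mathsf{DAA}$ be an instantly linkable direct anonymous attestation scheme that is correct. Then the TrollThrottle protocol built from $\mathsf{DAA}$, a collision-resistant hash function $h$ and a non-interactive proof of knowledge system for the relation $\mathcal{R}_{\mathsf{Join}}$ has a complete accountability mechanism: for every probabilistic polynomial-time (PPT) adversary $\mathcal{A}$, the probability $\Pr[\mathsf{Exp}^{\mathsf{acccompl}}_{\mathcal{A}}(1^\lambda)=1]$ is negligible in $\lambda$.
   Context: **DAA schemes.** A direct anonymous attestation (DAA) scheme consists of PPT algorithms and a protocol: $\mathsf{Setup}_{\mathsf{DAA}}(1^\lambda)$ outputs an issuer key pair $(\mathit{pk}_I,\mathit{sk}_I)$. In the protocol $\mathsf{Join\text{-}Issue}_{\mathsf{DAA}}$ a signer $S$ with secret key $\mathit{sk}_S$ computes $\mathsf{com}\leftarrow\mathsf{Join}_{\mathsf{DAA}}(\mathit{pk}_I,\mathit{sk}_S)$ and the issuer answers with a credential $\mathit{cred}_S\leftarrow\mathsf{Issue}_{\mathsf{DAA}}(\mathit{sk}_I,\mathsf{com})$. $\mathsf{Sign}_{\mathsf{DAA}}(\mathit{sk}_S,\mathit{cred}_S,\mathit{dom},m)$ outputs a signature $\sigma$ on $m$ w.r.t. basename $\mathit{dom}$. The deterministic $\mathsf{Verify}_{\mathsf{DAA}}(\mathit{pk}_I,m,\mathit{dom},\sigma,RL)\in\{0,1\}$ checks validity w.r.t. a list $RL$ of revoked secret keys; $RL_\emptyset$ is the empty list. $\mathsf{Link}_{\mathsf{DAA}}(\sigma_0,\sigma_1)$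 decides whether two signatures are linked. All basenames used in TrollThrottle are different from $\bot$. **Instantly linkable.** (1) There are deterministic poly-time algorithms $\mathsf{NymGen}$, $\mathsf{NymExtract}$ with $\mathsf{NymGen}(\mathit{sk}_S,\mathit{dom})=\mathsf{NymExtract}(\mathsf{Sign}_{\mathsf{DAA}}(\mathit{sk}_S,\mathit{cred},\mathit{dom},\cdot))$; (2) for all valid signatures $\sigma_1,\sigma_2$: $\mathsf{Link}_{\mathsf{DAA}}(\sigma_1,\sigma_2)=1$ iff $\mathsf{NymExtract}(\sigma_1)=\mathsf{NymExtract}(\sigma_2)$; (3) the basename used to create a signature can be checked and is uniquely determined: there is a poly-time algorithm $\mathsf{VerifyBsn}$ that outputs $1$ on $(\sigma,\mathit{dom})$ when $\sigma$ was created with basename $\mathit{dom}$, and it is infeasible for PPT algorithms to find $\mathit{dom}\neq\mathit{dom}'$, $\sigma$, $\mathit{pk}_I$, $m$ with $\mathsf{VerifyBsn}(\sigma,\mathit{dom})=\mathsf{VerifyBsn}(\sigma,\mathit{dom}')=1$ and $\mathsf{Verify}_{\mathsf{DAA}}(\mathit{pk}_I,m,\mathit{dom},\sigma,RL_\emptyset)=1$. **Correctness of DAA.** For any secret key $\mathit{sk}_S$ in the user's secret key space, if $(\mathit{pk}_I,\mathit{sk}_I)\leftarrow\mathsf{Setup}_{\mathsf{DAA}}(1^\lambda)$, $\mathsf{com}\leftarrow\mathsf{Join}_{\mathsf{DAA}}(\mathit{pk}_I,\mathit{sk}_S)$, $\mathit{cred}_S\leftarrow\mathsf{Issue}_{\mathsf{DAA}}(\mathit{sk}_I,\mathsf{com})$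 and $\sigma_i\leftarrow\mathsf{Sign}_{\mathsf{DAA}}(\mathit{sk}_S,\mathit{cred}_S,\mathit{dom},m_i)$ for $i\in\{0,1\}$, then with overwhelming probability $\mathsf{Verify}_{\mathsf{DAA}}(\mathit{pk}_I,m_i,\mathit{dom},\sigma_i,RL_\emptyset)=1$ for $i\in\{0,1\}$ and $\mathsf{Link}_{\mathsf{DAA}}(\sigma_0,\sigma_1)=1$. **Proof system.** A non-interactive proof system has algorithms $\mathsf{Setup}_{\mathsf{ZK}}(1^\lambda)\to\rho$, $\mathsf{CreateProof}(\rho,x,w)\to\pi$, $\mathsf{VerifyProof}(\rho,x,\pi)\in\{0,1\}$. The relation is $((\mathsf{com},\mathit{pk}_I),\mathit{sk}_S)\in\mathcal{R}_{\mathsf{Join}}$ iff $\mathsf{com}$ is an output of $\mathsf{Join}_{\mathsf{DAA}}(\mathit{pk}_I,\mathit{sk}_S)$ (the witness also contains the random coins). **TrollThrottle.** - $\mathsf{Setup}(1^\lambda)$: $\rho_{\mathsf{Join}}\leftarrow\mathsf{Setup}_{\mathsf{ZK}}(1^\lambda)$; output $\rho=(1^\lambda,\rho_{\mathsf{Join}})$. - $\mathsf{KeyGen}(\rho)$: run $\mathsf{Setup}_{\mathsf{DAA}}(1^\lambda)$; $\mathit{pk}_{\mathsf I}$ is the DAA issuer public key, $\mathit{sk}_{\mathsf I}$ the DAA issuer key pair. - $\mathsf{Join}(\mathit{pk}_{\mathsf I},\mathit{sk}_U,U)$: $\mathsf{com}\leftarrow\mathsf{Join}_{\mathsf{DAA}}(\mathit{pk}_{\mathsf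 I},\mathit{sk}_U)$; $\Pi_{\mathsf{Join}}=\mathsf{CreateProof}(\rho_{\mathsf{Join}},(\mathsf{com},\mathit{pk}_{\mathsf I}),\mathit{sk}_U)$; send $(\mathsf{com},\Pi_{\mathsf{Join}})$, receive $\mathit{cred}_U$, return $(\mathit{cred}_U,\mathit{sk}_U)$. - $\mathsf{Issue}(\mathit{sk}_{\mathsf I},\mathit{ver},U)$ (for a user that has not registered so far): receive $(\mathsf{com},\Pi_{\mathsf{Join}})$, abort if the proof is invalid, else send $\mathit{cred}_U\leftarrow\mathsf{Issue}_{\mathsf{DAA}}(\mathit{sk}_{\mathsf I},\mathsf{com})$. - $\mathsf{Comment}(\mathit{pk}_{\mathsf I},\mathit{sk}_U,\mathit{cred}_U,\mathit{dom},m)$: $\sigma\leftarrow\mathsf{Sign}_{\mathsf{DAA}}(\mathit{sk}_U,\mathit{cred}_U,\mathit{dom},h(m))$, $\mathit{nym}=\mathsf{NymGen}(\mathit{sk}_U,\mathit{dom})=\mathsf{NymExtract}(\sigma)$; output $\mathit{nym}$ and $\gamma=(\sigma,\mathit{nym},\mathit{dom},h(m))$. - $\mathsf{Verify}(\mathit{pk}_{\mathsf I},\mathit{nym},\mathit{dom},m,\gamma)$: parse $\gamma=(\sigma,\mathit{nym},\mathit{dom},h^* )$ (with the given $\mathit{nym},\mathit{dom}$); output $1$ iff $\mathsf{Verify}_{\mathsf{DAA}}(\mathit{pk}_{\mathsf I},h^*,\mathit{dom},\sigma,RL_\emptyset)=1$, $h(m)=h^*$, $\mathsf{NymExtract}(\sigma)=\mathit{nym}$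 and $\mathsf{VerifyBsn}(\sigma,\mathit{dom})=1$. - $\mathsf{Claim}(\mathit{pk}_{\mathsf I},\mathit{sk}_U,\mathit{cred}_U,\mathit{dom},m,\gamma)$: return $\mathit{evidence}=\gamma$. - $\mathsf{VerifyClaim}(\mathit{pk}_{\mathsf I},\mathit{dom},m,\gamma,\mathit{evidence})$: parse $\gamma=(\sigma,\mathit{nym},\mathit{dom},h^* )$ (with the given $\mathit{dom}$) and output $1$ iff $\mathsf{Verify}(\mathit{pk}_{\mathsf I},\mathit{nym},\mathit{dom},m,\gamma)=1$. **Oracles.** Global sets $\mathrm{CU},\mathrm{HU},\mathrm{VM},\mathrm{USK},\mathrm{COMM}$ are initially empty; $\mathit{ver}[V,U]\in\{0,1\}$ is initially $0$. - $\mathsf{CorruptUser}(U)$: if some $(U,\mathit{sk}_U,\mathit{cred}_U,\cdot)\in\mathrm{USK}$ output $(\mathit{sk}_U,\mathit{cred}_U)$, else $\bot$; add $U$ to $\mathrm{CU}$, remove it from $\mathrm{HU}$. - $\mathsf{CorruptVer}(U,V)$: set $\mathit{ver}[V,U]=1$, add $(V,U)$ to $\mathrm{VM}$. - $\mathsf{CreateHonestUser}(U,V)$: return $\bot$ if $U\in\mathrm{HU}\cup\mathrm{CU}$; set $\mathit{ver}[V,U]=1$, run the whole $\mathsf{Join}$–$\mathsf{Issue}$ protocol to get $(\mathit{sk}_U,\mathit{cred}_U)$, add $(U,\mathit{sk}_U,\mathit{cred}_U,V)$ to $\mathrm{USK}$ and $U$ to $\mathrm{HU}$. - $\mathsf{JoinSystem}(U,V)$: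 return $\bot$ unless $U\notin\mathrm{HU}\cup\mathrm{CU}$, $\mathit{ver}[V,U]=1$ and $U$ has not already registered through this oracle; otherwise execute $\mathsf{Issue}(\mathit{sk}_{\mathsf I},\mathit{ver},U)$ interactively with the adversary playing the user. - $\mathsf{CreateComment}(U,\mathit{dom},m)$: require $U\in\mathrm{HU}$; compute $(\mathit{nym},\gamma)\leftarrow\mathsf{Comment}(\mathit{pk}_{\mathsf I},\mathit{sk}_U,\mathit{cred}_U,\mathit{dom},m)$, add $(U,\mathit{nym},\mathit{dom},m,\gamma)$ to $\mathrm{COMM}$, output $(\gamma,\mathit{nym})$. **Experiment $\mathsf{Exp}^{\mathsf{acccompl}}_{\mathcal{A}}(1^\lambda)$.** Run $\rho\leftarrow\mathsf{Setup}(1^\lambda)$, $(\mathit{pk}_{\mathsf I},\mathit{sk}_{\mathsf I})\leftarrow\mathsf{KeyGen}(\rho)$. Run $\mathcal{A}(\rho,\mathit{pk}_{\mathsf I})$ with oracles $\mathsf{CorruptUser},\mathsf{CreateHonestUser},\mathsf{CorruptVer},\mathsf{CreateComment},\mathsf{JoinSystem}$, obtaining $(U^*,\mathit{nym}^*,\mathit{dom}^*,m^*,\gamma^*,\mathit{evidence}^* )$. Return $1$ iff there exist tuples $(U^*,\mathit{nym}^*,\mathit{dom}^*,m^*,\gamma^* )\in\mathrm{COMM}$ and $(U^*,\mathit{sk}_U,\mathit{cred}_U,\cdot)\in\mathrm{USK}$ such that $\mathsf{VerifyClaim}(\mathit{pk}_{\mathsf I},\mathit{dom}^*,m^*,\gamma^*,x)=0$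 for $x=\mathsf{Claim}(\mathit{pk}_{\mathsf I},\mathit{sk}_U,\mathit{cred}_U,\mathit{dom}^*,m^*,\gamma^* )$. *)

theory Defs
  imports "HOL-Probability.Probability" "HOL-Computational_Algebra.Polynomial" "HOL-Library.Monad_Syntax"
begin

section \<open>Bit strings and encodings\<close>

type_synonym bits = "bool list"

text \<open>Machines read and write bit strings; structured arguments and results are passed through a
  prefix-free (hence uniquely decodable) binary encoding.\<close>

class encodable =
  fixes enc :: "'a \<Rightarrow> bits"
  assumes enc_prefix_free: "enc x @ u = enc y @ v \<Longrightarrow> x = y \<and> u = v"

lemma inj_enc: "inj enc"
  using enc_prefix_free[where u = "[]" and v = "[]"] by (auto intro: injI)

definition decode :: "bits \<Rightarrow> 'a::encodable option" where
  "decode w = (if w \<in> range (enc :: 'a \<Rightarrow> bits) then Some (inv enc w) else None)"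

instantiation unit :: encodable
begin
definition "enc (x::unit) = []"
instance by standard (simp add: enc_unit_def)
end

instantiation bool :: encodable
begin
definition "enc (b::bool) = [b]"
instance by standard (simp add: enc_bool_def)
end

text \<open>Natural numbers are encoded in unary: \<open>\<lambda>\<close> is encoded as \<open>1\<close> repeated \<open>\<lambda>\<close> times.\<close>

instantiation nat :: encodable
begin
definition "enc (n::nat) = replicate n True @ [False]"
instance
proof
  fix x y :: nat and u v :: bits
  show "enc x @ u = enc y @ v \<Longrightarrow> x = y \<and> u = v"
    unfolding enc_nat_def
  proof (induction x arbitrary: y)
    case 0 then show ?case by (cases y) auto
  next
    case (Suc x) then show ?case by (cases y) auto
  qed
qed
end

instantiation prod :: (encodable, encodable) encodable
begin
definition "enc (p::'a \<times> 'b) = enc (fst p) @ enc (snd p)"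
instance
proof
  fix x y :: "'a \<times> 'b" and u v :: bits
  show "enc x @ u = enc y @ v \<Longrightarrow> x = y \<and> u = v"
    unfolding enc_prod_def append_assoc by (metis enc_prefix_free prod_eqI)
qed
end

instantiation option :: (encodable) encodable
begin
definition "enc (x::'a option) = (case x of None \<Rightarrow> [False] | Some a \<Rightarrow> True # enc a)"
instance
  by standard (auto simp: enc_option_def split: option.splits dest: enc_prefix_free)
end

instantiation list :: (encodable) encodable
begin
primrec enc_list :: "'a list \<Rightarrow> bits" where
  "enc_list [] = [False]"
| "enc_list (x # xs) = True # enc x @ enc_list xs"
instance
proof
  fix x y :: "'a list" and u v :: bits
  show "enc x @ u = enc y @ v \<Longrightarrow> x = y \<and> u = v"
  proof (induction x arbitrary: y)
    case Nil then show ?case by (cases y) auto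
  next
    case (Cons a x) then show ?case by (cases y) (auto dest!: enc_prefix_free)
  qed
qed
end

section \<open>Probabilistic polynomial-time oracle Turing machines\<close>

text \<open>Multi-tape machines over the tape alphabet \<open>{blank, 0, 1}\<close>, with \<open>None\<close> as the blank. Tape 0
  holds the input, tape 1 holds oracle queries and the final output, tape 2 receives oracle answers;
  further tapes are work tapes. State 0 is the start state, 1 the halting state, 2 the query state,
  and 3 the state in which the machine resumes after a query. The transition function receives the
  state, the scanned symbols and one fair coin.\<close>

datatype direction = Left | Stay | Right

record tm =
  tapes :: nat
  states :: nat
  delta :: "nat \<Rightarrow> bool option list \<Rightarrow> bool \<Rightarrow> nat \<times> (bool option \<times> direction) list"

text \<open>Well-formedness confines \<open>delta\<close> to finitely many states and scanned symbols, so that only a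
  finite transition table is ever consulted.\<close>

definition wf_tm :: "tm \<Rightarrow> bool" where
  "wf_tm M \<longleftrightarrow> 3 \<le> tapes M \<and> 4 \<le> states M \<and>
     (\<forall>q < states M. \<forall>rs b. length rs = tapes M \<longrightarrow>
        fst (delta M q rs b) < states M \<and> length (snd (delta M q rs b)) = tapes M)"

type_synonym tape = "(nat \<Rightarrow> bool option) \<times> nat"
type_synonym config = "nat \<times> tape list"

definition tape_of :: "bits \<Rightarrow> tape" where
  "tape_of w = ((\<lambda>i. if i < length w then Some (w ! i) else None), 0)"

definition word_of :: "tape \<Rightarrow> bits" where
  "word_of t = map (\<lambda>i. the (fst t i)) [0..<(LEAST i. fst t i = None)]"

primrec move :: "direction \<Rightarrow> nat \<Rightarrow> nat" where
  "move Left i = i - 1"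
| "move Stay i = i"
| "move Right i = Suc i"

definition init_config :: "tm \<Rightarrow> bits \<Rightarrow> config" where
  "init_config M w = (0, tape_of w # replicate (tapes M - 1) (tape_of []))"

definition tm_step :: "tm \<Rightarrow> bool \<Rightarrow> config \<Rightarrow> config" where
  "tm_step M b c = (case delta M (fst c) (map (\<lambda>(t, i). t i) (snd c)) b of (q, acts) \<Rightarrow>
     (q, map2 (\<lambda>(s, d) (t, i). (t(i := s), move d i)) acts (snd c)))"

definition resume :: "bits \<Rightarrow> config \<Rightarrow> config" where
  "resume a c = (3, (snd c)[1 := tape_of [], 2 := tape_of a])"

definition out_word :: "config \<Rightarrow> bits" where
  "out_word c = word_of (snd c ! 1)"

abbreviation halted :: "config \<Rightarrow> bool" where "halted c \<equiv> fst c = 1"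
abbreviation querying :: "config \<Rightarrow> bool" where "querying c \<equiv> fst c = 2"

text \<open>All configurations reachable in one step, for every coin and every oracle answer.\<close>

definition succs :: "tm \<Rightarrow> config \<Rightarrow> config set" where
  "succs M c = (if querying c then range (\<lambda>a. resume a c) else range (\<lambda>b. tm_step M b c))"

primrec halts_within :: "tm \<Rightarrow> nat \<Rightarrow> config \<Rightarrow> bool" where
  "halts_within M 0 c \<longleftrightarrow> halted c"
| "halts_within M (Suc n) c \<longleftrightarrow> halted c \<or> (\<forall>c' \<in> succs M c. halts_within M n c')"

text \<open>Strict polynomial time in the length of the input, whatever the coins and oracle answers.\<close>

definition ppt_tm :: "tm \<Rightarrow> bool" where
  "ppt_tm M \<longleftrightarrow> wf_tm M \<and>
     (\<exists>p :: nat poly. \<forall>w. halts_within M (poly p (length w)) (init_config M w))"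

definition deterministic_tm :: "tm \<Rightarrow> bool" where
  "deterministic_tm M \<longleftrightarrow> (\<forall>q rs. delta M q rs True = delta M q rs False)"

text \<open>Execution with a stateful probabilistic oracle.\<close>

definition run_step ::
  "tm \<Rightarrow> ('s \<Rightarrow> bits \<Rightarrow> (bits \<times> 's) pmf) \<Rightarrow> config \<times> 's \<Rightarrow> (config \<times> 's) pmf" where
  "run_step M Or = (\<lambda>(c, s).
     if halted c then return_pmf (c, s)
     else if querying c then map_pmf (\<lambda>(a, s'). (resume a c, s')) (Or s (out_word c))
     else map_pmf (\<lambda>b. (tm_step M b c, s)) (bernoulli_pmf (1/2)))"

primrec run_steps ::
  "tm \<Rightarrow> ('s \<Rightarrow> bits \<Rightarrow> (bits \<times> 's) pmf) \<Rightarrow> nat \<Rightarrow> config \<times> 's \<Rightarrow> (config \<times> 's) pmf" where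
  "run_steps M Or 0 cs = return_pmf cs"
| "run_steps M Or (Suc n) cs = run_step M Or cs \<bind> run_steps M Or n"

text \<open>Output and final oracle state of a run to completion. Halted configurations no longer change,
  so any number of steps within which the machine certainly halts gives the same result; the
  definition is meaningful only for machines that always halt within a fixed number of steps on
  the given input.\<close>

definition run_tm ::
  "tm \<Rightarrow> ('s \<Rightarrow> bits \<Rightarrow> (bits \<times> 's) pmf) \<Rightarrow> bits \<Rightarrow> 's \<Rightarrow> (bits \<times> 's) pmf" where
  "run_tm M Or w s = map_pmf (\<lambda>(c, s'). (out_word c, s'))
     (run_steps M Or (LEAST n. halts_within M n (init_config M w)) (init_config M w, s))"

definition no_oracle :: "unit \<Rightarrow> bits \<Rightarrow> (bits \<times> unit) pmf" where
  "no_oracle s w = return_pmf ([], ())"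

definition computes :: "tm \<Rightarrow> ('a::encodable \<Rightarrow> 'b::encodable pmf) \<Rightarrow> bool" where
  "computes M f \<longleftrightarrow> (\<forall>x. map_pmf fst (run_tm M no_oracle (enc x) ()) = map_pmf enc (f x))"

definition ppt :: "('a::encodable \<Rightarrow> 'b::encodable pmf) \<Rightarrow> bool" where
  "ppt f \<longleftrightarrow> (\<exists>M. ppt_tm M \<and> computes M f)"

definition poly_time :: "('a::encodable \<Rightarrow> 'b::encodable) \<Rightarrow> bool" where
  "poly_time f \<longleftrightarrow> (\<exists>M. ppt_tm M \<and> deterministic_tm M \<and> computes M (\<lambda>x. return_pmf (f x)))"

definition negligible_fun :: "(nat \<Rightarrow> real) \<Rightarrow> bool" where
  "negligible_fun \<mu> \<longleftrightarrow> (\<forall>c::nat. \<forall>\<^sub>F n in sequentially. \<bar>\<mu> n\<bar> < 1 / real n ^ c)"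

section \<open>Direct anonymous attestation\<close>

text \<open>The basename argument of signing and verification is \<open>None\<close> for the basename \<open>\<bottom>\<close>, for which
  signatures are not meant to be linkable. \<open>join_alg\<close> is the joining algorithm with its random coins
  as an explicit third argument; their
  number is the polynomial \<open>join_coins\<close> of the input length.
  \<open>ukey_daa\<close> is the distribution of the secret keys of honest signers.\<close>

record daa =
  setup_daa :: "nat \<Rightarrow> (bits \<times> bits) pmf"
  keyspace :: "nat \<Rightarrow> bits set"
  ukey_daa :: "nat \<Rightarrow> bits pmf"
  join_alg :: "bits \<Rightarrow> bits \<Rightarrow> bits \<Rightarrow> bits"
  join_coins :: "nat poly"
  issue_daa :: "bits \<Rightarrow> bits \<Rightarrow> bits pmf"
  sign_daa :: "bits \<Rightarrow> bits \<Rightarrow> bits option \<Rightarrow> bits \<Rightarrow> bits pmf"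
  verify_daa :: "bits \<Rightarrow> bits \<Rightarrow> bits option \<Rightarrow> bits \<Rightarrow> bits list \<Rightarrow> bool"
  link_daa :: "bits \<Rightarrow> bits \<Rightarrow> bool"

definition coin_space :: "('z) daa_scheme \<Rightarrow> bits \<Rightarrow> bits \<Rightarrow> bits set" where
  "coin_space D pk sk = {r. length r = poly (join_coins D) (length (enc (pk, sk)))}"

definition join_daa :: "('z) daa_scheme \<Rightarrow> bits \<Rightarrow> bits \<Rightarrow> bits pmf" where
  "join_daa D pk sk = map_pmf (join_alg D pk sk) (pmf_of_set (coin_space D pk sk))"

definition efficient_daa :: "('z) daa_scheme \<Rightarrow> bool" where
  "efficient_daa D \<longleftrightarrow>
     ppt (setup_daa D) \<and> ppt (ukey_daa D) \<and>
     (\<forall>\<eta>. set_pmf (ukey_daa D \<eta>) \<subseteq> keyspace D \<eta>) \<and>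
     poly_time (\<lambda>(pk, sk, r). join_alg D pk sk r) \<and>
     ppt (\<lambda>(skI, com). issue_daa D skI com) \<and>
     ppt (\<lambda>(sk, cred, bsn, m). sign_daa D sk cred bsn m) \<and>
     poly_time (\<lambda>(pk, m, bsn, \<sigma>, RL). verify_daa D pk m bsn \<sigma> RL) \<and>
     poly_time (\<lambda>(\<sigma>0, \<sigma>1). link_daa D \<sigma>0 \<sigma>1)"

text \<open>The basename and the messages are quantified after the keys and the credential: \<open>choice\<close> may
  depend on them arbitrarily. If they were fixed before key generation, a correct scheme could
  reject, say, the basename that equals the issuer's public key, which an adaptive adversary would
  exploit. Linking is required for basenames other than \<open>\<bottom>\<close> only.\<close>

definition correctness_exp ::
  "('z) daa_scheme \<Rightarrow> nat \<Rightarrow> bits \<Rightarrow> (bits \<Rightarrow> bits \<Rightarrow> bits \<Rightarrow> bits \<Rightarrow> bits option \<times> bits \<times> bits) \<Rightarrow> bool pmf"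
where
  "correctness_exp D \<eta> sk choice = do {
     (pk, skI) \<leftarrow> setup_daa D \<eta>;
     com \<leftarrow> join_daa D pk sk;
     cred \<leftarrow> issue_daa D skI com;
     let (bsn, m0, m1) = choice pk skI com cred;
     \<sigma>0 \<leftarrow> sign_daa D sk cred bsn m0;
     \<sigma>1 \<leftarrow> sign_daa D sk cred bsn m1;
     return_pmf (verify_daa D pk m0 bsn \<sigma>0 [] \<and> verify_daa D pk m1 bsn \<sigma>1 [] \<and>
                 (bsn \<noteq> None \<longrightarrow> link_daa D \<sigma>0 \<sigma>1))
   }"

definition correct_daa :: "('z) daa_scheme \<Rightarrow> bool" where
  "correct_daa D \<longleftrightarrow> (\<exists>\<mu>. negligible_fun \<mu> \<and>
     (\<forall>\<eta>. \<forall>sk \<in> keyspace D \<eta>. \<forall>choice. pmf (correctness_exp D \<eta> sk choice) True \<ge> 1 - \<mu> \<eta>))"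

record ildaa = daa +
  nym_gen :: "bits \<Rightarrow> bits \<Rightarrow> bits"
  nym_extract :: "bits \<Rightarrow> bits"
  verify_bsn :: "bits \<Rightarrow> bits \<Rightarrow> bool"

text \<open>\<open>\<sigma>\<close> was created with \<open>bsn\<close> under the secret key \<open>sk\<close> and a credential issued for \<open>sk\<close>.\<close>

definition created_with :: "('z) daa_scheme \<Rightarrow> bits \<Rightarrow> bits \<Rightarrow> bits \<Rightarrow> bool" where
  "created_with D sk bsn \<sigma> \<longleftrightarrow> (\<exists>\<eta> pk skI com cred m.
     sk \<in> keyspace D \<eta> \<and> (pk, skI) \<in> set_pmf (setup_daa D \<eta>) \<and>
     com \<in> set_pmf (join_daa D pk sk) \<and> cred \<in> set_pmf (issue_daa D skI com) \<and>
     \<sigma> \<in> set_pmf (sign_daa D sk cred (Some bsn) m))"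

definition valid_signature :: "('z) daa_scheme \<Rightarrow> bits \<Rightarrow> bool" where
  "valid_signature D \<sigma> \<longleftrightarrow> (\<exists>pk m bsn. verify_daa D pk m (Some bsn) \<sigma> [])"

definition instantly_linkable :: "ildaa \<Rightarrow> bool" where
  "instantly_linkable D \<longleftrightarrow>
     poly_time (\<lambda>(sk, bsn). nym_gen D sk bsn) \<and> poly_time (nym_extract D) \<and>
     (\<forall>sk bsn \<sigma>. created_with D sk bsn \<sigma> \<longrightarrow> nym_gen D sk bsn = nym_extract D \<sigma>) \<and>
     (\<forall>\<sigma>1 \<sigma>2. valid_signature D \<sigma>1 \<and> valid_signature D \<sigma>2 \<longrightarrow>
        (link_daa D \<sigma>1 \<sigma>2 \<longleftrightarrow> nym_extract D \<sigma>1 = nym_extract D \<sigma>2)) \<and>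
     poly_time (\<lambda>(\<sigma>, bsn). verify_bsn D \<sigma> bsn) \<and>
     (\<forall>sk bsn \<sigma>. created_with D sk bsn \<sigma> \<longrightarrow> verify_bsn D \<sigma> bsn) \<and>
     (\<forall>A :: nat \<Rightarrow> (bits \<times> bits \<times> bits \<times> bits \<times> bits) pmf. ppt A \<longrightarrow>
        negligible_fun (\<lambda>\<eta>. measure_pmf.prob (A \<eta>) {(bsn, bsn', \<sigma>, pk, m).
          bsn \<noteq> bsn' \<and> verify_bsn D \<sigma> bsn \<and> verify_bsn D \<sigma> bsn' \<and>
          verify_daa D pk m (Some bsn) \<sigma> []}))"

section \<open>Hash functions and non-interactive proofs of knowledge\<close>

text \<open>An unkeyed family indexed by the security parameter; adversaries are uniform.\<close>

definition collision_resistant_hash :: "(nat \<Rightarrow> bits \<Rightarrow> bits) \<Rightarrow> bool" where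
  "collision_resistant_hash h \<longleftrightarrow>
     poly_time (\<lambda>(\<eta>, m). h \<eta> m) \<and> (\<exists>l. \<forall>\<eta> m. length (h \<eta> m) = l \<eta>) \<and>
     (\<forall>A :: nat \<Rightarrow> (bits \<times> bits) pmf. ppt A \<longrightarrow>
        negligible_fun (\<lambda>\<eta>. measure_pmf.prob (A \<eta>) {(m, m'). m \<noteq> m' \<and> h \<eta> m = h \<eta> m'}))"

record ('x, 'w) proof_system =
  setup_zk :: "nat \<Rightarrow> bits pmf"
  create_proof :: "bits \<Rightarrow> 'x \<Rightarrow> 'w \<Rightarrow> bits pmf"
  verify_proof :: "bits \<Rightarrow> 'x \<Rightarrow> bits \<Rightarrow> bool"

text \<open>Knowledge extraction in the common reference string model: the extractor \<open>E1\<close> produces an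
  indistinguishable reference string together with a trapdoor, with which \<open>E2\<close> extracts a witness
  from every accepting proof except with negligible probability.\<close>

definition proof_of_knowledge ::
  "('x::encodable \<Rightarrow> 'w::encodable \<Rightarrow> bool) \<Rightarrow> ('x, 'w) proof_system \<Rightarrow> bool" where
  "proof_of_knowledge R Z \<longleftrightarrow>
     ppt (setup_zk Z) \<and> ppt (\<lambda>(\<rho>, x, w). create_proof Z \<rho> x w) \<and>
     poly_time (\<lambda>(\<rho>, x, \<pi>). verify_proof Z \<rho> x \<pi>) \<and>
     (\<exists>\<mu>. negligible_fun \<mu> \<and> (\<forall>\<eta> x w. R x w \<longrightarrow>
        pmf (do { \<rho> \<leftarrow> setup_zk Z \<eta>; \<pi> \<leftarrow> create_proof Z \<rho> x w;
                  return_pmf (verify_proof Z \<rho> x \<pi>) }) True \<ge> 1 - \<mu> \<eta>)) \<and>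
     (\<exists>(E1 :: nat \<Rightarrow> (bits \<times> bits) pmf) (E2 :: bits \<times> bits \<times> 'x \<times> bits \<Rightarrow> 'w pmf).
        ppt E1 \<and> ppt E2 \<and>
        (\<forall>A :: nat \<times> bits \<Rightarrow> bool pmf. ppt A \<longrightarrow>
           negligible_fun (\<lambda>\<eta>. pmf (setup_zk Z \<eta> \<bind> (\<lambda>\<rho>. A (\<eta>, \<rho>))) True
                          - pmf (E1 \<eta> \<bind> (\<lambda>(\<rho>, \<tau>). A (\<eta>, \<rho>))) True)) \<and>
        (\<forall>A :: nat \<times> bits \<Rightarrow> ('x \<times> bits) pmf. ppt A \<longrightarrow>
           negligible_fun (\<lambda>\<eta>. pmf (do {
             (\<rho>, \<tau>) \<leftarrow> E1 \<eta>;
             (x, \<pi>) \<leftarrow> A (\<eta>, \<rho>);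
             w \<leftarrow> E2 (\<rho>, \<tau>, x, \<pi>);
             return_pmf (verify_proof Z \<rho> x \<pi> \<and> \<not> R x w) }) True)))"

definition R_Join :: "('z) daa_scheme \<Rightarrow> bits \<times> bits \<Rightarrow> bits \<times> bits \<Rightarrow> bool" where
  "R_Join D = (\<lambda>(com, pk) (sk, r). r \<in> coin_space D pk sk \<and> join_alg D pk sk r = com)"

type_synonym join_proof_system = "(bits \<times> bits, bits \<times> bits) proof_system"

section \<open>TrollThrottle\<close>

type_synonym params = "nat \<times> bits"
type_synonym comment = "bits \<times> bits \<times> bits \<times> bits"

definition tt_setup :: "join_proof_system \<Rightarrow> nat \<Rightarrow> params pmf" where
  "tt_setup Z \<eta> = map_pmf (Pair \<eta>) (setup_zk Z \<eta>)"

text \<open>The issuer's secret key is the whole DAA issuer key pair.\<close>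

definition tt_keygen :: "ildaa \<Rightarrow> params \<Rightarrow> (bits \<times> (bits \<times> bits)) pmf" where
  "tt_keygen D \<rho> = map_pmf (\<lambda>(pk, sk). (pk, (pk, sk))) (setup_daa D (fst \<rho>))"

definition tt_join_msg ::
  "ildaa \<Rightarrow> join_proof_system \<Rightarrow> params \<Rightarrow> bits \<Rightarrow> bits \<Rightarrow> (bits \<times> bits) pmf" where
  "tt_join_msg D Z \<rho> pk sk = do {
     r \<leftarrow> pmf_of_set (coin_space D pk sk);
     let com = join_alg D pk sk r;
     \<pi> \<leftarrow> create_proof Z (snd \<rho>) (com, pk) (sk, r);
     return_pmf (com, \<pi>)
   }"

text \<open>\<open>None\<close> means that the issuer aborts.\<close>

definition tt_issue ::
  "ildaa \<Rightarrow> join_proof_system \<Rightarrow> params \<Rightarrow> bits \<times> bits \<Rightarrow> bits \<times> bits \<Rightarrow> bits option pmf" where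
  "tt_issue D Z \<rho> = (\<lambda>(pk, skI) (com, \<pi>).
     if verify_proof Z (snd \<rho>) (com, pk) \<pi> then map_pmf Some (issue_daa D skI com)
     else return_pmf None)"

definition tt_comment ::
  "ildaa \<Rightarrow> (nat \<Rightarrow> bits \<Rightarrow> bits) \<Rightarrow> params \<Rightarrow> bits \<Rightarrow> bits \<Rightarrow> bits \<Rightarrow> bits \<Rightarrow> bits \<Rightarrow> (bits \<times> comment) pmf"
where
  "tt_comment D h \<rho> pk sk cred bsn m = do {
     \<sigma> \<leftarrow> sign_daa D sk cred (Some bsn) (h (fst \<rho>) m);
     let nym = nym_gen D sk bsn;
     return_pmf (nym, (\<sigma>, nym, bsn, h (fst \<rho>) m))
   }"

definition tt_verify ::
  "ildaa \<Rightarrow> (nat \<Rightarrow> bits \<Rightarrow> bits) \<Rightarrow> params \<Rightarrow> bits \<Rightarrow> bits \<Rightarrow> bits \<Rightarrow> bits \<Rightarrow> comment \<Rightarrow> bool" where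
  "tt_verify D h \<rho> pk nym bsn m \<gamma> = (case \<gamma> of (\<sigma>, nym', bsn', hm) \<Rightarrow>
     nym' = nym \<and> bsn' = bsn \<and>
     verify_daa D pk hm (Some bsn) \<sigma> [] \<and> h (fst \<rho>) m = hm \<and>
     nym_extract D \<sigma> = nym \<and> verify_bsn D \<sigma> bsn)"

definition tt_claim :: "bits \<Rightarrow> bits \<Rightarrow> bits \<Rightarrow> bits \<Rightarrow> bits \<Rightarrow> comment \<Rightarrow> comment" where
  "tt_claim pk sk cred bsn m \<gamma> = \<gamma>"

definition tt_verify_claim ::
  "ildaa \<Rightarrow> (nat \<Rightarrow> bits \<Rightarrow> bits) \<Rightarrow> params \<Rightarrow> bits \<Rightarrow> bits \<Rightarrow> bits \<Rightarrow> comment \<Rightarrow> comment \<Rightarrow> bool" where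
  "tt_verify_claim D h \<rho> pk bsn m \<gamma> evidence = (case \<gamma> of (\<sigma>, nym, bsn', hm) \<Rightarrow>
     bsn' = bsn \<and> tt_verify D h \<rho> pk nym bsn m \<gamma>)"

section \<open>Oracles and the experiment\<close>

text \<open>\<open>USK\<close> is a finite map, since at most one entry \<open>(sk, cred, V)\<close> is ever added for a user.
  \<open>REG\<close> contains the users who registered through the oracle \<open>JoinSystem\<close>.\<close>

record game_state =
  CU :: "bits set"
  HU :: "bits set"
  VM :: "(bits \<times> bits) set"
  USK :: "bits \<rightharpoonup> bits \<times> bits \<times> bits"
  COMM :: "(bits \<times> bits \<times> bits \<times> bits \<times> comment) set"
  VER :: "bits \<Rightarrow> bits \<Rightarrow> bool"
  REG :: "bits set"

definition init_state :: game_state where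
  "init_state = \<lparr>CU = {}, HU = {}, VM = {}, USK = Map.empty, COMM = {}, VER = (\<lambda>V U. False), REG = {}\<rparr>"

text \<open>In the protocol with the issuer, the user moves first and receives one reply. The query
  \<open>JoinSystem\<close> therefore carries the user's message chosen by the adversary.\<close>

datatype query =
    CorruptUser bits
  | CorruptVer bits bits
  | CreateHonestUser bits bits
  | JoinSystem bits bits "bits \<times> bits"
  | CreateComment bits bits bits

instantiation query :: encodable
begin
primrec enc_query :: "query \<Rightarrow> bits" where
  "enc_query (CorruptUser U) = [False, False, False] @ enc U"
| "enc_query (CorruptVer U V) = [False, False, True] @ enc (U, V)"
| "enc_query (CreateHonestUser U V) = [False, True, False] @ enc (U, V)"
| "enc_query (JoinSystem U V msg) = [False, True, True] @ enc (U, V, msg)"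
| "enc_query (CreateComment U bsn m) = [True, False, False] @ enc (U, bsn, m)"
instance
proof
  fix x y :: query and u v :: bits
  show "enc x @ u = enc y @ v \<Longrightarrow> x = y \<and> u = v"
    by (cases x; cases y) (auto dest!: enc_prefix_free)
qed
end

definition corrupt_user :: "bits \<Rightarrow> game_state \<Rightarrow> ((bits \<times> bits) option \<times> game_state) pmf" where
  "corrupt_user U s = return_pmf
     (map_option (\<lambda>(sk, cred, V). (sk, cred)) (USK s U),
      s\<lparr>CU := insert U (CU s), HU := HU s - {U}\<rparr>)"

definition set_ver :: "bits \<Rightarrow> bits \<Rightarrow> game_state \<Rightarrow> game_state" where
  "set_ver V U s = s\<lparr>VER := (VER s)(V := (VER s V)(U := True))\<rparr>"

definition corrupt_ver :: "bits \<Rightarrow> bits \<Rightarrow> game_state \<Rightarrow> (unit \<times> game_state) pmf" where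
  "corrupt_ver U V s = return_pmf ((), (set_ver V U s)\<lparr>VM := insert (V, U) (VM s)\<rparr>)"

text \<open>If the issuer aborts, no credential exists and the user is not created.\<close>

definition create_honest_user ::
  "ildaa \<Rightarrow> join_proof_system \<Rightarrow> params \<Rightarrow> bits \<Rightarrow> bits \<times> bits \<Rightarrow> bits \<Rightarrow> bits \<Rightarrow> game_state
     \<Rightarrow> (unit option \<times> game_state) pmf" where
  "create_honest_user D Z \<rho> pk skI U V s =
     (if U \<in> HU s \<union> CU s then return_pmf (None, s)
      else do {
        let s' = set_ver V U s;
        sk \<leftarrow> ukey_daa D (fst \<rho>);
        msg \<leftarrow> tt_join_msg D Z \<rho> pk sk;
        reply \<leftarrow> tt_issue D Z \<rho> skI msg;
        return_pmf (case reply of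
          None \<Rightarrow> (None, s')
        | Some cred \<Rightarrow> (Some (), s'\<lparr>USK := (USK s')(U \<mapsto> (sk, cred, V)), HU := insert U (HU s')\<rparr>))
      })"

definition join_system ::
  "ildaa \<Rightarrow> join_proof_system \<Rightarrow> params \<Rightarrow> bits \<times> bits \<Rightarrow> bits \<Rightarrow> bits \<Rightarrow> bits \<times> bits \<Rightarrow> game_state
     \<Rightarrow> (bits option \<times> game_state) pmf" where
  "join_system D Z \<rho> skI U V msg s =
     (if U \<in> HU s \<union> CU s \<or> \<not> VER s V U \<or> U \<in> REG s then return_pmf (None, s)
      else do {
        reply \<leftarrow> tt_issue D Z \<rho> skI msg;
        return_pmf (reply, if reply = None then s else s\<lparr>REG := insert U (REG s)\<rparr>)
      })"

definition create_comment ::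
  "ildaa \<Rightarrow> (nat \<Rightarrow> bits \<Rightarrow> bits) \<Rightarrow> params \<Rightarrow> bits \<Rightarrow> bits \<Rightarrow> bits \<Rightarrow> bits \<Rightarrow> game_state
     \<Rightarrow> ((comment \<times> bits) option \<times> game_state) pmf" where
  "create_comment D h \<rho> pk U bsn m s =
     (if U \<notin> HU s then return_pmf (None, s)
      else case USK s U of
        None \<Rightarrow> return_pmf (None, s)
      | Some (sk, cred, V) \<Rightarrow> do {
          (nym, \<gamma>) \<leftarrow> tt_comment D h \<rho> pk sk cred bsn m;
          return_pmf (Some (\<gamma>, nym), s\<lparr>COMM := insert (U, nym, bsn, m, \<gamma>) (COMM s)\<rparr>)
        })"

definition encode_answer :: "('a::encodable \<times> game_state) pmf \<Rightarrow> (bits \<times> game_state) pmf" where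
  "encode_answer = map_pmf (\<lambda>(a, s). (enc a, s))"

definition acccompl_oracle ::
  "ildaa \<Rightarrow> (nat \<Rightarrow> bits \<Rightarrow> bits) \<Rightarrow> join_proof_system \<Rightarrow> params \<Rightarrow> bits \<Rightarrow> bits \<times> bits
     \<Rightarrow> game_state \<Rightarrow> bits \<Rightarrow> (bits \<times> game_state) pmf" where
  "acccompl_oracle D h Z \<rho> pk skI s w = (case decode w of
       None \<Rightarrow> return_pmf ([], s)
     | Some (CorruptUser U) \<Rightarrow> encode_answer (corrupt_user U s)
     | Some (CorruptVer U V) \<Rightarrow> encode_answer (corrupt_ver U V s)
     | Some (CreateHonestUser U V) \<Rightarrow> encode_answer (create_honest_user D Z \<rho> pk skI U V s)
     | Some (JoinSystem U V msg) \<Rightarrow> encode_answer (join_system D Z \<rho> skI U V msg s)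
     | Some (CreateComment U bsn m) \<Rightarrow> encode_answer (create_comment D h \<rho> pk U bsn m s))"

type_synonym accompl_output = "bits \<times> bits \<times> bits \<times> bits \<times> comment \<times> comment"

definition exp_acccompl ::
  "ildaa \<Rightarrow> (nat \<Rightarrow> bits \<Rightarrow> bits) \<Rightarrow> join_proof_system \<Rightarrow> tm \<Rightarrow> nat \<Rightarrow> bool pmf" where
  "exp_acccompl D h Z A \<eta> = do {
     \<rho> \<leftarrow> tt_setup Z \<eta>;
     (pk, skI) \<leftarrow> tt_keygen D \<rho>;
     (out, s) \<leftarrow> run_tm A (acccompl_oracle D h Z \<rho> pk skI) (enc (\<rho>, pk)) init_state;
     return_pmf (case (decode out :: accompl_output option) of
       None \<Rightarrow> False
     | Some (U, nym, bsn, m, \<gamma>, evidence) \<Rightarrow>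
         (U, nym, bsn, m, \<gamma>) \<in> COMM s \<and>
         (\<exists>sk cred V. USK s U = Some (sk, cred, V) \<and>
            \<not> tt_verify_claim D h \<rho> pk bsn m \<gamma> (tt_claim pk sk cred bsn m \<gamma>)))
   }"

end

theory Submission
  imports Defs
begin

text \<open>A logged comment was produced by honest signing with an honestly issued credential, so its
  pseudonym and basename always check out and a claim can fail only because the DAA signature is
  rejected. For each user the supremum of the rejection probability over all basenames and messages
  bounds every adaptive choice of the adversary, and by correctness this supremum is negligible in
  expectation over the keys and the credential. An adversary making at most \<open>T\<close> queries thus wins with
  probability at most \<open>T\<^sup>2\<close> times that expectation, and \<open>T\<close> is polynomial since the input of the
  adversary, being the output of polynomial-time machines, has polynomial length.\<close>

section \<open>Polynomial bounds and negligible functions\<close>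

lemma poly_nat_mono: "x \<le> y \<Longrightarrow> poly p x \<le> poly (p :: nat poly) y"
  by (induction p) (auto intro!: add_mono mult_mono)

text \<open>Adding a coefficient costs two in the exponent: one for the factor \<open>n\<close> in
  \<open>pCons\<close>, one to absorb the 2 from adding two summands once
  \<open>n \<ge> 2\<close>.\<close>

lemma eventually_poly_nat_le_power:
  "\<exists>k. \<forall>\<^sub>F n in sequentially. poly (p :: nat poly) n \<le> n ^ k"
proof (induction p)
  case 0
  then show ?case by auto
next
  case (pCons a p)
  then obtain k where k: "\<forall>\<^sub>F n in sequentially. poly p n \<le> n ^ k" by blast
  have "\<forall>\<^sub>F n in sequentially. poly (pCons a p) n \<le> n ^ (k + 2)"
    using k eventually_ge_at_top[of "max 2 a"]
  proof eventually_elim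
    case (elim n)
    have "a \<le> n ^ (k + 1)" using elim self_le_power[of n "k + 1"] by linarith
    then have "poly (pCons a p) n \<le> n ^ (k + 1) + n * n ^ k"
      unfolding poly_pCons using elim by (intro add_mono mult_left_mono) auto
    also have "\<dots> = 2 * n ^ (k + 1)" by simp
    also have "\<dots> \<le> n * n ^ (k + 1)" using elim by (intro mult_right_mono) auto
    finally show ?case by simp
  qed
  then show ?case by blast
qed

text \<open>Since \<open>p\<close> is eventually at most \<open>n ^ k\<close>, negligibility of
  \<open>\<mu>\<close> with exponent \<open>k + c\<close> gives exponent \<open>c\<close> for
  \<open>f\<close>.\<close>

lemma negligible_fun_poly_mult:
  assumes "negligible_fun \<mu>" and bound: "\<And>n. \<bar>f n\<bar> \<le> real (poly p n) * \<bar>\<mu> n\<bar>"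
  shows "negligible_fun f"
  unfolding negligible_fun_def
proof
  fix c
  obtain k where k: "\<forall>\<^sub>F n in sequentially. poly p n \<le> n ^ k"
    using eventually_poly_nat_le_power by blast
  have "\<forall>\<^sub>F n in sequentially. \<bar>\<mu> n\<bar> < 1 / real n ^ (k + c)"
    using assms(1) by (simp add: negligible_fun_def)
  with k eventually_gt_at_top[of 0]
  show "\<forall>\<^sub>F n in sequentially. \<bar>f n\<bar> < 1 / real n ^ c"
  proof eventually_elim
    case (elim n)
    have "real (poly p n) \<le> real n ^ k"
      using elim by (metis of_nat_le_iff of_nat_power)
    then have "real (poly p n) * \<bar>\<mu> n\<bar> \<le> real n ^ k * \<bar>\<mu> n\<bar>"
      by (intro mult_right_mono) auto
    also have "\<dots> < real n ^ k * (1 / real n ^ (k + c))"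
      using elim by (intro mult_strict_left_mono) auto
    also have "\<dots> = 1 / real n ^ c" using elim by (simp add: power_add)
    finally show ?case using bound[of n] by linarith
  qed
qed

section \<open>Output length of machines\<close>

text \<open>An invariant of the output tape whose bound grows by one per step: a head at
  \<open>k\<close> or before writes at most cell \<open>k\<close> and moves at most to
  \<open>k + 1\<close>. The length conjunct makes \<open>snd c ! 1\<close> meaningful.\<close>

definition output_within :: "nat \<Rightarrow> config \<Rightarrow> bool" where
  "output_within k c \<longleftrightarrow>
     (let (t, i) = snd c ! 1 in 1 < length (snd c) \<and> i \<le> k \<and> (\<forall>j\<ge>k. t j = None))"

lemma output_within_Suc: "output_within k c \<Longrightarrow> output_within (Suc k) c"
  by (auto simp: output_within_def)

lemma output_within_init: "wf_tm M \<Longrightarrow> output_within 0 (init_config M w)"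
  by (auto simp: output_within_def init_config_def wf_tm_def tape_of_def)

text \<open>A query erases tape 1 and puts the answer on tape 2, so the length of the answer has no
  influence.\<close>

lemma output_within_resume: "output_within k c \<Longrightarrow> output_within k (resume a c)"
  by (auto simp: output_within_def resume_def tape_of_def Let_def split: prod.splits)

lemma move_le: "move d i \<le> Suc i"
  by (cases d) auto

lemma output_within_tm_step:
  assumes "wf_tm M" "fst c < states M" "length (snd c) = tapes M" "output_within k c"
  shows "output_within (Suc k) (tm_step M b c)"
proof -
  define r where "r = delta M (fst c) (map (\<lambda>(t, i). t i) (snd c)) b"
  have len: "length (snd r) = tapes M" and tapes: "3 \<le> tapes M"
    using assms(1-3) by (auto simp: r_def wf_tm_def)
  obtain t i where ti: "snd c ! 1 = (t, i)" by force
  obtain s d where sd: "snd r ! 1 = (s, d)" by force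
  have "snd (tm_step M b c) ! 1 = (t(i := s), move d i)"
    using len tapes assms(3) ti sd by (auto simp: tm_step_def r_def[symmetric] split: prod.splits)
  moreover have "length (snd (tm_step M b c)) = tapes M"
    using len assms(3) by (auto simp: tm_step_def r_def[symmetric] split: prod.splits)
  ultimately show ?thesis
    using assms(4) tapes ti move_le[of d i] by (auto simp: output_within_def)
qed

lemma wf_tm_step:
  assumes "wf_tm M" "fst c < states M" "length (snd c) = tapes M"
  shows "fst (tm_step M b c) < states M \<and> length (snd (tm_step M b c)) = tapes M"
proof -
  have "length (map (\<lambda>(t, i). t i) (snd c)) = tapes M" using assms(3) by simp
  then show ?thesis
    using assms unfolding wf_tm_def tm_step_def by (auto simp: case_prod_beta)
qed

lemma run_steps_output_within:
  assumes "wf_tm M" "fst c < states M" "length (snd c) = tapes M" "output_within k c"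
    and "(c', s') \<in> set_pmf (run_steps M Or n (c, s))"
  shows "output_within (k + n) c'"
  using assms(2-)
proof (induction n arbitrary: c s k)
  case 0
  then show ?case by simp
next
  case (Suc n)
  from Suc.prems(4) obtain c1 s1 where
    step: "(c1, s1) \<in> set_pmf (run_step M Or (c, s))" and
    rest: "(c', s') \<in> set_pmf (run_steps M Or n (c1, s1))"
    by auto
  from step consider "c1 = c" | a where "c1 = resume a c" | b where "c1 = tm_step M b c"
    by (auto simp: run_step_def split: if_splits)
  then have "fst c1 < states M \<and> length (snd c1) = tapes M \<and> output_within (Suc k) c1"
  proof cases
    case 1
    then show ?thesis using Suc.prems(1-3) output_within_Suc by simp
  next
    case 2
    \<comment> \<open>Resumption enters state 3, which is below \<open>states M\<close> because
      well-formed machines have at least four states.\<close>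
    then show ?thesis
      using Suc.prems(2,3) assms(1) output_within_Suc output_within_resume
      by (simp add: resume_def wf_tm_def)
  next
    case 3
    then show ?thesis
      using Suc.prems(1-3) wf_tm_step[OF assms(1)] output_within_tm_step[OF assms(1)] by simp
  qed
  then show ?case using Suc.IH[OF _ _ _ rest] by fastforce
qed

text \<open>The output word ends at the first blank, and cell \<open>k\<close> is blank.\<close>

lemma output_within_length: "output_within k c \<Longrightarrow> length (out_word c) \<le> k"
  by (auto simp: output_within_def out_word_def word_of_def intro: Least_le split: prod.splits)

text \<open>This is the step count used inside \<open>run_tm\<close>. It is a worst case over coins
  and oracle answers, hence independent of the oracle.\<close>

definition run_time :: "tm \<Rightarrow> bits \<Rightarrow> nat" where
  "run_time M w = (LEAST n. halts_within M n (init_config M w))"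

lemma run_time_poly:
  assumes "ppt_tm M"
  obtains p :: "nat poly" where "\<And>w. run_time M w \<le> poly p (length w)"
  using assms unfolding ppt_tm_def run_time_def by (metis Least_le)

text \<open>At most one output cell is filled per step, so the running time bounds the output. This
  later bounds the length of the key and parameters handed to the adversary.\<close>

lemma ppt_output_length:
  assumes "ppt f"
  obtains p :: "nat poly" where "\<And>x y. y \<in> set_pmf (f x) \<Longrightarrow> length (enc y) \<le> poly p (length (enc x))"
proof -
  obtain M where M: "ppt_tm M" "computes M f" using assms by (auto simp: ppt_def)
  obtain p :: "nat poly" where p: "\<And>w. run_time M w \<le> poly p (length w)"
    using run_time_poly M(1) by blast
  have wf: "wf_tm M" using M(1) by (simp add: ppt_tm_def)
  have "length (enc y) \<le> poly p (length (enc x))" if "y \<in> set_pmf (f x)" for x y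
  proof -
    have "enc y \<in> set_pmf (map_pmf fst (run_tm M no_oracle (enc x) ()))"
      using M(2) that by (simp add: computes_def)
    then obtain c s where c: "(c, s) \<in> set_pmf (run_steps M no_oracle (run_time M (enc x))
        (init_config M (enc x), ()))" and out: "enc y = out_word c"
      by (auto simp: run_tm_def run_time_def)
    have "output_within (0 + run_time M (enc x)) c"
      using wf by (intro run_steps_output_within[OF wf _ _ output_within_init c])
        (auto simp: init_config_def wf_tm_def)
    then show ?thesis using output_within_length p[of "enc x"] out by fastforce
  qed
  then show ?thesis using that by blast
qed

section \<open>The potential of a game state\<close>

text \<open>A supermartingale argument: \<open>\<Phi> n s\<close> bounds the expected final value
  with \<open>n\<close> steps left. Only a query changes the oracle state; halted and coin steps are
  covered by \<open>mono\<close>. Counting steps instead of queries is safe, as each query takes a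
  step.\<close>

lemma run_steps_potential:
  fixes \<Phi> :: "nat \<Rightarrow> 's \<Rightarrow> ennreal"
  assumes step: "\<And>n s w. (\<integral>\<^sup>+ x. \<Phi> n (snd x) \<partial>measure_pmf (Or s w)) \<le> \<Phi> (Suc n) s"
    and mono: "\<And>n s. \<Phi> n s \<le> \<Phi> (Suc n) s"
  shows "(\<integral>\<^sup>+ x. \<Phi> 0 (snd x) \<partial>measure_pmf (run_steps M Or n cs)) \<le> \<Phi> n (snd cs)"
proof (induction n arbitrary: cs)
  case 0
  then show ?case by simp
next
  case (Suc n)
  obtain c s where cs: "cs = (c, s)" by (cases cs)
  have "(\<integral>\<^sup>+ x. \<Phi> 0 (snd x) \<partial>measure_pmf (run_steps M Or (Suc n) cs)) =
      (\<integral>\<^sup>+ y. (\<integral>\<^sup>+ x. \<Phi> 0 (snd x) \<partial>measure_pmf (run_steps M Or n y)) \<partial>measure_pmf (run_step M Or cs))"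
    by simp
  also have "\<dots> \<le> (\<integral>\<^sup>+ y. \<Phi> n (snd y) \<partial>measure_pmf (run_step M Or cs))"
    by (intro nn_integral_mono Suc)
  also have "\<dots> \<le> \<Phi> (Suc n) (snd cs)"
    using step[where n = n and s = s and w = "out_word c"] mono[where n = n and s = s]
    by (auto simp: cs run_step_def case_prod_beta measure_pmf.emeasure_space_1[simplified])
  finally show ?case .
qed

section \<open>Failure probabilities and the potential function\<close>

text \<open>The comment serves as its own evidence because \<open>tt_claim\<close> returns it
  unchanged.\<close>

definition claim_fails ::
  "ildaa \<Rightarrow> (nat \<Rightarrow> bits \<Rightarrow> bits) \<Rightarrow> params \<Rightarrow> bits \<Rightarrow> bits \<Rightarrow> bits \<Rightarrow> comment \<Rightarrow> bool" where
  "claim_fails D h \<rho> pk bsn m \<gamma> \<longleftrightarrow> \<not> tt_verify_claim D h \<rho> pk bsn m \<gamma> \<gamma>"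

definition comment_failure ::
  "ildaa \<Rightarrow> (nat \<Rightarrow> bits \<Rightarrow> bits) \<Rightarrow> params \<Rightarrow> bits \<Rightarrow> bits \<Rightarrow> bits \<Rightarrow> ennreal" where
  "comment_failure D h \<rho> pk sk cred = (SUP (bsn, m).
     \<integral>\<^sup>+ x. of_bool (claim_fails D h \<rho> pk bsn m (snd x)) \<partial>measure_pmf (tt_comment D h \<rho> pk sk cred bsn m))"

text \<open>Averages over the creation of a user once the issuer keys are fixed. The joining proof
  is left out: it affects only whether a credential is issued, and an abort adds no user.\<close>

definition user_failure ::
  "ildaa \<Rightarrow> (nat \<Rightarrow> bits \<Rightarrow> bits) \<Rightarrow> params \<Rightarrow> bits \<Rightarrow> bits \<Rightarrow> ennreal" where
  "user_failure D h \<rho> pk skI = (\<integral>\<^sup>+ sk. \<integral>\<^sup>+ com. \<integral>\<^sup>+ cred. comment_failure D h \<rho> pk sk cred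
     \<partial>measure_pmf (issue_daa D skI com) \<partial>measure_pmf (join_daa D pk sk) \<partial>measure_pmf (ukey_daa D (fst \<rho>)))"

text \<open>Corrupted users stay in the table and are still counted, so the value does not depend on
  \<open>HU\<close> and \<open>CU\<close>; an empty table has value 0.\<close>

definition worst_failure ::
  "ildaa \<Rightarrow> (nat \<Rightarrow> bits \<Rightarrow> bits) \<Rightarrow> params \<Rightarrow> bits \<Rightarrow> (bits \<rightharpoonup> bits \<times> bits \<times> bits) \<Rightarrow> ennreal" where
  "worst_failure D h \<rho> pk K =
     (SUP U. case K U of None \<Rightarrow> 0 | Some (sk, cred, V) \<Rightarrow> comment_failure D h \<rho> pk sk cred)"

text \<open>Relaxes the winning condition: some failing comment is logged, whether or not the
  adversary outputs it.\<close>

definition bad_state ::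
  "ildaa \<Rightarrow> (nat \<Rightarrow> bits \<Rightarrow> bits) \<Rightarrow> params \<Rightarrow> bits \<Rightarrow> game_state \<Rightarrow> bool" where
  "bad_state D h \<rho> pk s \<longleftrightarrow> (\<exists>(U, nym, bsn, m, \<gamma>) \<in> COMM s. claim_fails D h \<rho> pk bsn m \<gamma>)"

lemma bad_stateI: "(U, nym, bsn, m, \<gamma>) \<in> COMM s \<Longrightarrow> claim_fails D h \<rho> pk bsn m \<gamma> \<Longrightarrow> bad_state D h \<rho> pk s"
  unfolding bad_state_def by blast

text \<open>With \<open>n\<close> queries left, at most \<open>n\<close> comments of the present users and at most \<open>n\<^sup>2\<close> pairs of
  a later user and a comment can still fail.\<close>

definition potential ::
  "ildaa \<Rightarrow> (nat \<Rightarrow> bits \<Rightarrow> bits) \<Rightarrow> params \<Rightarrow> bits \<Rightarrow> bits \<Rightarrow> nat \<Rightarrow> game_state \<Rightarrow> ennreal" where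
  "potential D h \<rho> pk skI n s = of_bool (bad_state D h \<rho> pk s) +
     of_nat n * worst_failure D h \<rho> pk (USK s) + of_nat (n * n) * user_failure D h \<rho> pk skI"

text \<open>The slack in \<open>(n + 1) * (n + 1) \<ge> n * n + n\<close> and in the linear term
  pays for one query: a comment spends the extra \<open>worst_failure\<close>, a new user the extra
  multiple of \<open>user_failure\<close>.\<close>

lemma potential_add:
  "potential D h \<rho> pk skI n s + worst_failure D h \<rho> pk (USK s) + of_nat n * user_failure D h \<rho> pk skI
     \<le> potential D h \<rho> pk skI (Suc n) s"
proof -
  have "of_nat (n * n) * user_failure D h \<rho> pk skI + of_nat n * user_failure D h \<rho> pk skI
      \<le> (of_nat (Suc n * Suc n) :: ennreal) * user_failure D h \<rho> pk skI"
    unfolding distrib_right[symmetric] of_nat_add[symmetric]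
    by (intro mult_right_mono of_nat_mono) auto
  from add_left_mono[OF this, of "of_bool (bad_state D h \<rho> pk s) +
      of_nat (Suc n) * worst_failure D h \<rho> pk (USK s)"]
  show ?thesis unfolding potential_def by (simp add: algebra_simps)
qed

lemma potential_mono: "potential D h \<rho> pk skI n s \<le> potential D h \<rho> pk skI (Suc n) s"
  using potential_add[of D h \<rho> pk skI n s] by (rule order_trans[rotated]) (intro add_increasing2; simp)

lemma potential_cong:
  "USK s' = USK s \<Longrightarrow> COMM s' = COMM s \<Longrightarrow> potential D h \<rho> pk skI n s' = potential D h \<rho> pk skI n s"
  by (simp add: potential_def bad_state_def)

text \<open>A sum replaces the maximum of the old supremum and the new entry because it splits under
  expectations; an overwritten entry is covered too.\<close>

lemma worst_failure_upd:
  "worst_failure D h \<rho> pk (K(U \<mapsto> (sk, cred, V))) \<le>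
     worst_failure D h \<rho> pk K + comment_failure D h \<rho> pk sk cred"
proof -
  have "(case (K(U \<mapsto> (sk, cred, V))) U' of None \<Rightarrow> 0
      | Some (sk, cred, V) \<Rightarrow> comment_failure D h \<rho> pk sk cred)
    \<le> worst_failure D h \<rho> pk K + comment_failure D h \<rho> pk sk cred" for U'
  proof (cases "U' = U")
    case False
    have "(case K U' of None \<Rightarrow> 0 | Some (sk, cred, V) \<Rightarrow> comment_failure D h \<rho> pk sk cred)
        \<le> worst_failure D h \<rho> pk K"
      unfolding worst_failure_def by (rule SUP_upper) simp
    with False show ?thesis by (auto intro: add_increasing2)
  qed (simp add: add_increasing)
  then show ?thesis by (subst worst_failure_def) (rule SUP_least)
qed

lemma nn_integral_pmf_cmult: "(\<integral>\<^sup>+ x. c * f x \<partial>measure_pmf p) = c * (\<integral>\<^sup>+ x. f x \<partial>measure_pmf p)"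
  by (rule nn_integral_cmult) simp

lemma nn_integral_pmf_const [simp]: "(\<integral>\<^sup>+ x. c \<partial>measure_pmf p) = c"
  by (simp add: measure_pmf.emeasure_space_1[simplified])

section \<open>Effect of each oracle query on the potential\<close>

text \<open>A new comment raises the potential only through the indicator of
  \<open>bad_state\<close>, in expectation by at most the \<open>comment_failure\<close> of its
  author, hence by at most \<open>worst_failure\<close>.\<close>

lemma create_comment_potential:
  "(\<integral>\<^sup>+ x. potential D h \<rho> pk skI n (snd x) \<partial>measure_pmf (create_comment D h \<rho> pk U bsn m s))
     \<le> potential D h \<rho> pk skI (Suc n) s"
proof (cases "U \<in> HU s \<and> USK s U \<noteq> None")
  case False
  then show ?thesis
    using potential_mono[of D h \<rho> pk skI n s] by (auto simp: create_comment_def split: option.split)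
next
  case True
  then obtain sk cred V where U: "U \<in> HU s" "USK s U = Some (sk, cred, V)" by auto
  let ?P = "potential D h \<rho> pk skI n"
  have step: "?P (s\<lparr>COMM := insert (U, nym, bsn, m, \<gamma>) (COMM s)\<rparr>)
      \<le> ?P s + of_bool (claim_fails D h \<rho> pk bsn m \<gamma>)" for nym \<gamma>
    by (auto simp: potential_def bad_state_def algebra_simps of_bool_def)
  have "(\<integral>\<^sup>+ x. ?P (snd x) \<partial>measure_pmf (create_comment D h \<rho> pk U bsn m s)) =
     (\<integral>\<^sup>+ x. ?P (s\<lparr>COMM := insert (U, fst x, bsn, m, snd x) (COMM s)\<rparr>)
        \<partial>measure_pmf (tt_comment D h \<rho> pk sk cred bsn m))"
    using U by (simp add: create_comment_def case_prod_beta)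
  also have "\<dots> \<le> (\<integral>\<^sup>+ x. ?P s + of_bool (claim_fails D h \<rho> pk bsn m (snd x))
        \<partial>measure_pmf (tt_comment D h \<rho> pk sk cred bsn m))"
    by (intro nn_integral_mono step)
  also have "\<dots> = ?P s + (\<integral>\<^sup>+ x. of_bool (claim_fails D h \<rho> pk bsn m (snd x))
        \<partial>measure_pmf (tt_comment D h \<rho> pk sk cred bsn m))"
    by (subst nn_integral_add) auto
  also have "\<dots> \<le> ?P s + comment_failure D h \<rho> pk sk cred"
    unfolding comment_failure_def by (intro add_left_mono SUP_upper2[where i = "(bsn, m)"]) auto
  also have "\<dots> \<le> ?P s + worst_failure D h \<rho> pk (USK s)"
    unfolding worst_failure_def using U by (intro add_left_mono SUP_upper2[where i = U]) auto
  also have "\<dots> \<le> potential D h \<rho> pk skI (Suc n) s"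
    by (rule order_trans[OF _ potential_add]) (rule add_increasing2; simp)
  finally show ?thesis .
qed

text \<open>A new user raises \<open>worst_failure\<close> by at most its own
  \<open>comment_failure\<close>, which counts \<open>n\<close> times for the remaining queries;
  averaging over its key and credential gives \<open>n\<close> times
  \<open>user_failure\<close>.\<close>

lemma create_honest_user_potential:
  "(\<integral>\<^sup>+ x. potential D h \<rho> pk skI n (snd x) \<partial>measure_pmf (create_honest_user D Z \<rho> pk (pk, skI) U V s))
     \<le> potential D h \<rho> pk skI (Suc n) s"
proof (cases "U \<in> HU s \<union> CU s")
  case True
  then show ?thesis
    using potential_mono[of D h \<rho> pk skI n s] by (auto simp: create_honest_user_def)
next
  case False
  let ?P = "potential D h \<rho> pk skI n"
  let ?F = "comment_failure D h \<rho> pk"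
  define s1 where "s1 = set_ver V U s"
  have s1: "USK s1 = USK s" "COMM s1 = COMM s" by (auto simp: s1_def set_ver_def)
  define upd where "upd sk cred = s1\<lparr>USK := (USK s1)(U \<mapsto> (sk, cred, V)), HU := insert U (HU s1)\<rparr>"
    for sk cred
  \<comment> \<open>Names the outcome for a given issuer reply, so that the reply can be bounded
    separately before averaging over the earlier choices.\<close>
  define nxt where "nxt sk reply = (case reply of None \<Rightarrow> (None, s1) | Some cred \<Rightarrow> (Some (), upd sk cred))"
    for sk and reply :: "bits option"
  have upd: "?P (upd sk cred) \<le> ?P s + of_nat n * ?F sk cred" for sk cred
  proof -
    have "?P (upd sk cred) \<le> of_bool (bad_state D h \<rho> pk s) +
        of_nat n * (worst_failure D h \<rho> pk (USK s) + ?F sk cred) +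
        of_nat (n * n) * user_failure D h \<rho> pk skI"
      unfolding potential_def
      by (intro add_mono mult_left_mono)
        (auto simp: upd_def s1 bad_state_def intro!: worst_failure_upd)
    then show ?thesis by (simp add: potential_def algebra_simps)
  qed
  have issue: "(\<integral>\<^sup>+ reply. ?P (snd (nxt sk reply)) \<partial>measure_pmf (tt_issue D Z \<rho> (pk, skI) (com, \<pi>)))
      \<le> ?P s + of_nat n * (\<integral>\<^sup>+ cred. ?F sk cred \<partial>measure_pmf (issue_daa D skI com))" for sk com \<pi>
  proof (cases "verify_proof Z (snd \<rho>) (com, pk) \<pi>")
    case True
    have "(\<integral>\<^sup>+ cred. ?P (upd sk cred) \<partial>measure_pmf (issue_daa D skI com))
        \<le> (\<integral>\<^sup>+ cred. ?P s + of_nat n * ?F sk cred \<partial>measure_pmf (issue_daa D skI com))"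
      by (intro nn_integral_mono upd)
    then show ?thesis
      using True by (simp add: tt_issue_def nxt_def nn_integral_add nn_integral_pmf_cmult)
  next
    case False
    then show ?thesis
      using potential_cong[OF s1] by (simp add: tt_issue_def nxt_def add_increasing2)
  qed
  have "(\<integral>\<^sup>+ x. ?P (snd x) \<partial>measure_pmf (create_honest_user D Z \<rho> pk (pk, skI) U V s)) =
    (\<integral>\<^sup>+ sk. \<integral>\<^sup>+ r. \<integral>\<^sup>+ \<pi>. \<integral>\<^sup>+ reply. ?P (snd (nxt sk reply))
        \<partial>measure_pmf (tt_issue D Z \<rho> (pk, skI) (join_alg D pk sk r, \<pi>))
        \<partial>measure_pmf (create_proof Z (snd \<rho>) (join_alg D pk sk r, pk) (sk, r))
        \<partial>measure_pmf (pmf_of_set (coin_space D pk sk)) \<partial>measure_pmf (ukey_daa D (fst \<rho>)))"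
    using False unfolding nxt_def upd_def
    by (simp add: create_honest_user_def Let_def s1_def[symmetric] tt_join_msg_def)
  also have "\<dots> \<le> (\<integral>\<^sup>+ sk. \<integral>\<^sup>+ r. \<integral>\<^sup>+ \<pi>. ?P s + of_nat n *
          (\<integral>\<^sup>+ cred. ?F sk cred \<partial>measure_pmf (issue_daa D skI (join_alg D pk sk r)))
        \<partial>measure_pmf (create_proof Z (snd \<rho>) (join_alg D pk sk r, pk) (sk, r))
        \<partial>measure_pmf (pmf_of_set (coin_space D pk sk)) \<partial>measure_pmf (ukey_daa D (fst \<rho>)))"
    by (intro nn_integral_mono issue)
  \<comment> \<open>The integral over \<open>\<pi>\<close> is of a constant, and the image of the
    uniform coins under \<open>join_alg\<close> is \<open>join_daa\<close>.\<close>
  also have "\<dots> = ?P s + of_nat n * user_failure D h \<rho> pk skI"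
    by (simp add: nn_integral_add nn_integral_pmf_cmult user_failure_def join_daa_def)
  also have "\<dots> \<le> potential D h \<rho> pk skI (Suc n) s"
    by (rule order_trans[OF _ potential_add]) (intro add_right_mono add_increasing2; simp)
  finally show ?thesis .
qed

lemma join_system_unchanged:
  "x \<in> set_pmf (join_system D Z \<rho> skI U V msg s) \<Longrightarrow> USK (snd x) = USK s \<and> COMM (snd x) = COMM s"
  by (auto simp: join_system_def split: if_splits)

text \<open>Only user creation and comments alter the key table or the log; for all other queries,
  and undecodable ones, monotonicity in \<open>n\<close> suffices. The issuer key has the form
  \<open>(pk, skI)\<close> produced by \<open>tt_keygen\<close>.\<close>

lemma oracle_potential:
  "(\<integral>\<^sup>+ x. potential D h \<rho> pk skI n (snd x) \<partial>measure_pmf (acccompl_oracle D h Z \<rho> pk (pk, skI) s w))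
     \<le> potential D h \<rho> pk skI (Suc n) s"
proof -
  have unchanged: "(\<integral>\<^sup>+ x. potential D h \<rho> pk skI n (snd x) \<partial>measure_pmf p) \<le> potential D h \<rho> pk skI (Suc n) s"
    if "\<And>x. x \<in> set_pmf p \<Longrightarrow> USK (snd x) = USK s \<and> COMM (snd x) = COMM s" for p :: "('x \<times> game_state) pmf"
  proof -
    have "(\<integral>\<^sup>+ x. potential D h \<rho> pk skI n (snd x) \<partial>measure_pmf p) =
        (\<integral>\<^sup>+ x. potential D h \<rho> pk skI n s \<partial>measure_pmf p)"
      using that by (intro nn_integral_cong_AE) (auto simp: AE_measure_pmf_iff intro: potential_cong)
    then show ?thesis using potential_mono[of D h \<rho> pk skI n s] by simp
  qed
  have [simp]: "(\<integral>\<^sup>+ x. f (snd x) \<partial>measure_pmf (encode_answer p)) = (\<integral>\<^sup>+ x. f (snd x) \<partial>measure_pmf p)"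
    for f :: "game_state \<Rightarrow> ennreal" and p :: "('x::encodable \<times> game_state) pmf"
    by (simp add: encode_answer_def case_prod_beta)
  show ?thesis
  proof (cases "decode w :: query option")
    case None
    then show ?thesis by (simp add: acccompl_oracle_def potential_mono)
  next
    case (Some q)
    show ?thesis
    proof (cases q)
      case (CorruptUser U)
      have "(\<integral>\<^sup>+ x. potential D h \<rho> pk skI n (snd x) \<partial>measure_pmf (corrupt_user U s))
          \<le> potential D h \<rho> pk skI (Suc n) s"
        by (rule unchanged) (auto simp: corrupt_user_def)
      with Some CorruptUser show ?thesis by (simp add: acccompl_oracle_def)
    next
      case (CorruptVer U V)
      have "(\<integral>\<^sup>+ x. potential D h \<rho> pk skI n (snd x) \<partial>measure_pmf (corrupt_ver U V s))
          \<le> potential D h \<rho> pk skI (Suc n) s"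
        by (rule unchanged) (auto simp: corrupt_ver_def set_ver_def)
      with Some CorruptVer show ?thesis by (simp add: acccompl_oracle_def)
    next
      case (CreateHonestUser U V)
      with Some show ?thesis by (simp add: acccompl_oracle_def create_honest_user_potential)
    next
      case (JoinSystem U V msg)
      have "(\<integral>\<^sup>+ x. potential D h \<rho> pk skI n (snd x) \<partial>measure_pmf (join_system D Z \<rho> (pk, skI) U V msg s))
          \<le> potential D h \<rho> pk skI (Suc n) s"
        by (rule unchanged) (rule join_system_unchanged)
      with Some JoinSystem show ?thesis by (simp add: acccompl_oracle_def)
    next
      case (CreateComment U bsn m)
      with Some show ?thesis by (simp add: acccompl_oracle_def create_comment_potential)
    qed
  qed
qed

section \<open>Failure probability of honest users\<close>

text \<open>For honestly created signatures instant linkability settles the pseudonym and basename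
  tests, and the hash test compares equal values. Only the signature test remains, for the
  particular message \<open>h (fst \<rho>) m\<close>.\<close>

lemma comment_failure_le:
  assumes il: "instantly_linkable D" and created: "\<And>bsn m \<sigma>. \<sigma> \<in> set_pmf (sign_daa D sk cred (Some bsn) m)
      \<Longrightarrow> created_with D sk bsn \<sigma>"
  shows "comment_failure D h \<rho> pk sk cred \<le> (SUP (bsn, m).
    \<integral>\<^sup>+ \<sigma>. of_bool (\<not> verify_daa D pk m (Some bsn) \<sigma> []) \<partial>measure_pmf (sign_daa D sk cred (Some bsn) m))"
  unfolding comment_failure_def
proof (intro SUP_least, clarify)
  have nym: "\<And>bsn \<sigma>. created_with D sk bsn \<sigma> \<Longrightarrow> nym_extract D \<sigma> = nym_gen D sk bsn"
    and bsn: "\<And>bsn \<sigma>. created_with D sk bsn \<sigma> \<Longrightarrow> verify_bsn D \<sigma> bsn"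
    using il by (simp_all add: instantly_linkable_def)
  fix bsn m
  have "(\<integral>\<^sup>+ x. of_bool (claim_fails D h \<rho> pk bsn m (snd x)) \<partial>measure_pmf (tt_comment D h \<rho> pk sk cred bsn m))
    = (\<integral>\<^sup>+ \<sigma>. of_bool (claim_fails D h \<rho> pk bsn m (\<sigma>, nym_gen D sk bsn, bsn, h (fst \<rho>) m))
        \<partial>measure_pmf (sign_daa D sk cred (Some bsn) (h (fst \<rho>) m)))"
    by (simp add: tt_comment_def Let_def)
  also have "\<dots> = (\<integral>\<^sup>+ \<sigma>. of_bool (\<not> verify_daa D pk (h (fst \<rho>) m) (Some bsn) \<sigma> [])
        \<partial>measure_pmf (sign_daa D sk cred (Some bsn) (h (fst \<rho>) m)))"
    using created nym bsn
    by (intro nn_integral_cong_AE AE_pmfI)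
      (simp add: claim_fails_def tt_verify_claim_def tt_verify_def)
  also have "\<dots> \<le> (SUP (bsn, m). \<integral>\<^sup>+ \<sigma>. of_bool (\<not> verify_daa D pk m (Some bsn) \<sigma> [])
      \<partial>measure_pmf (sign_daa D sk cred (Some bsn) m))"
    by (rule SUP_upper2[where i = "(bsn, h (fst \<rho>) m)"]) auto
  finally show "(\<integral>\<^sup>+ x. of_bool (claim_fails D h \<rho> pk bsn m (snd x)) \<partial>measure_pmf (tt_comment D h \<rho> pk sk cred bsn m))
    \<le> (SUP (bsn, m). \<integral>\<^sup>+ \<sigma>. of_bool (\<not> verify_daa D pk m (Some bsn) \<sigma> [])
      \<partial>measure_pmf (sign_daa D sk cred (Some bsn) m))" .
qed

section \<open>Worst basenames and messages in the correctness experiment\<close>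

text \<open>A supremum need not be attained, but an index within a factor 2 of it suffices to select
  the basename and message fed to the correctness experiment.\<close>

lemma SUP_ennreal_near_attained:
  fixes f :: "'i \<Rightarrow> ennreal"
  assumes "\<And>i. f i \<le> 1"
  shows "\<exists>i. (SUP i. f i) \<le> 2 * f i"
proof (cases "(SUP i. f i) = 0")
  case False
  have "(SUP i. f i) \<le> 1" using assms by (rule SUP_least)
  then have fin: "(SUP i. f i) < \<top>" by (metis ennreal_one_less_top le_less_trans)
  show ?thesis
  proof (rule ccontr)
    assume "\<nexists>i. (SUP i. f i) \<le> 2 * f i"
    then have "2 * f i \<le> (SUP i. f i)" for i by (simp add: not_le less_imp_le)
    \<comment> \<open>Twice a finite nonzero supremum cannot be at most the supremum itself; the
      bound by 1 supplies finiteness.\<close>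
    then have "2 * (SUP i. f i) \<le> (SUP i. f i)"
      unfolding SUP_mult_left_ennreal by (rule SUP_least)
    then have "(SUP i. f i) + (SUP i. f i) \<le> (SUP i. f i) + 0"
      by (simp only: mult_2 add_0_right)
    with fin False show False
      unfolding ennreal_add_left_cancel_le infinity_ennreal_def by (metis le_zero_eq less_irrefl)
  qed
qed auto

definition sign_failure :: "ildaa \<Rightarrow> bits \<Rightarrow> bits \<Rightarrow> bits \<Rightarrow> bits \<times> bits \<Rightarrow> ennreal" where
  "sign_failure D pk sk cred = (\<lambda>(bsn, m).
    \<integral>\<^sup>+ \<sigma>. of_bool (\<not> verify_daa D pk m (Some bsn) \<sigma> []) \<partial>measure_pmf (sign_daa D sk cred (Some bsn) m))"

text \<open>The universal quantification over \<open>choice\<close> in the correctness of the scheme turns the bound on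
  the expected failure probability into one on its expected supremum over basenames and messages.\<close>

lemma worst_sign_failure_le:
  assumes corr: "\<And>choice. pmf (correctness_exp D \<eta> sk choice) True \<ge> 1 - \<mu>"
  shows "(\<integral>\<^sup>+ (pk, skI). \<integral>\<^sup>+ com. \<integral>\<^sup>+ cred. (SUP i. sign_failure D pk sk cred i)
     \<partial>measure_pmf (issue_daa D skI com) \<partial>measure_pmf (join_daa D pk sk) \<partial>measure_pmf (setup_daa D \<eta>))
     \<le> 2 * ennreal \<mu>"
proof -
  have "sign_failure D pk sk cred i \<le> 1" for pk cred i
  proof -
    have "sign_failure D pk sk cred i \<le> (\<integral>\<^sup>+ \<sigma>. 1 \<partial>measure_pmf (sign_daa D sk cred (Some (fst i)) (snd i)))"
      unfolding sign_failure_def case_prod_beta by (intro nn_integral_mono) auto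
    then show ?thesis by simp
  qed
  then have "\<exists>i. (SUP i. sign_failure D pk sk cred i) \<le> 2 * sign_failure D pk sk cred i" for pk cred
    by (rule SUP_ennreal_near_attained)
  then obtain worst where worst:
    "\<And>pk cred. (SUP i. sign_failure D pk sk cred i) \<le> 2 * sign_failure D pk sk cred (worst pk cred)"
    by metis
  \<comment> \<open>One near-worst message fills both slots; rejection of the first signature
    already makes the experiment fail.\<close>
  define choice where "choice pk skI com cred =
      (Some (fst (worst pk cred)), snd (worst pk cred), snd (worst pk cred))"
    for pk and skI com :: bits and cred
  \<comment> \<open>\<open>bsn\<close>, \<open>m\<close> and \<open>m'\<close> are tied to
    \<open>choice\<close> by equations so that the rule matches the projections in the unfolded
    experiment.\<close>
  have le: "sign_failure D pk sk cred (worst pk cred) \<le>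
      (\<integral>\<^sup>+ \<sigma>0. \<integral>\<^sup>+ \<sigma>1. of_bool (\<not> (verify_daa D pk m bsn \<sigma>0 [] \<and> verify_daa D pk m' bsn \<sigma>1 [] \<and>
          (bsn \<noteq> None \<longrightarrow> link_daa D \<sigma>0 \<sigma>1)))
         \<partial>measure_pmf (sign_daa D sk cred bsn m') \<partial>measure_pmf (sign_daa D sk cred bsn m))"
    if "bsn = fst (choice pk skI com cred)" "m = fst (snd (choice pk skI com cred))"
      "m' = snd (snd (choice pk skI com cred))" for pk skI com cred bsn m m'
  proof -
    have "sign_failure D pk sk cred (worst pk cred) =
      (\<integral>\<^sup>+ \<sigma>0. \<integral>\<^sup>+ \<sigma>1. of_bool (\<not> verify_daa D pk m bsn \<sigma>0 [])
         \<partial>measure_pmf (sign_daa D sk cred bsn m') \<partial>measure_pmf (sign_daa D sk cred bsn m))"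
      using that by (auto simp: choice_def sign_failure_def case_prod_beta)
    also have "\<dots> \<le> (\<integral>\<^sup>+ \<sigma>0. \<integral>\<^sup>+ \<sigma>1. of_bool (\<not> (verify_daa D pk m bsn \<sigma>0 [] \<and> verify_daa D pk m' bsn \<sigma>1 [] \<and>
          (bsn \<noteq> None \<longrightarrow> link_daa D \<sigma>0 \<sigma>1)))
         \<partial>measure_pmf (sign_daa D sk cred bsn m') \<partial>measure_pmf (sign_daa D sk cred bsn m))"
      by (intro nn_integral_mono) auto
    finally show ?thesis .
  qed
  have "(\<integral>\<^sup>+ (pk, skI). \<integral>\<^sup>+ com. \<integral>\<^sup>+ cred. sign_failure D pk sk cred (worst pk cred)
     \<partial>measure_pmf (issue_daa D skI com) \<partial>measure_pmf (join_daa D pk sk) \<partial>measure_pmf (setup_daa D \<eta>))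
     \<le> (\<integral>\<^sup>+ b. of_bool (\<not> b) \<partial>measure_pmf (correctness_exp D \<eta> sk choice))"
    unfolding correctness_exp_def Let_def case_prod_beta
    by (simp only: nn_integral_bind_pmf nn_integral_return_pmf zero_le)
      (intro nn_integral_mono, rule le; rule refl)
  also have "\<dots> = ennreal (pmf (correctness_exp D \<eta> sk choice) False)"
    by (simp add: nn_integral_measure_pmf nn_integral_count_space_finite UNIV_bool)
  also have "\<dots> \<le> ennreal \<mu>"
    using corr[of choice] by (intro ennreal_leI) (simp add: pmf_False_conv_True)
  finally have "2 * (\<integral>\<^sup>+ (pk, skI). \<integral>\<^sup>+ com. \<integral>\<^sup>+ cred. sign_failure D pk sk cred (worst pk cred)
     \<partial>measure_pmf (issue_daa D skI com) \<partial>measure_pmf (join_daa D pk sk) \<partial>measure_pmf (setup_daa D \<eta>))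
     \<le> 2 * ennreal \<mu>"
    by (rule mult_left_mono) simp
  moreover have "(\<integral>\<^sup>+ (pk, skI). \<integral>\<^sup>+ com. \<integral>\<^sup>+ cred. (SUP i. sign_failure D pk sk cred i)
     \<partial>measure_pmf (issue_daa D skI com) \<partial>measure_pmf (join_daa D pk sk) \<partial>measure_pmf (setup_daa D \<eta>))
     \<le> 2 * (\<integral>\<^sup>+ (pk, skI). \<integral>\<^sup>+ com. \<integral>\<^sup>+ cred. sign_failure D pk sk cred (worst pk cred)
     \<partial>measure_pmf (issue_daa D skI com) \<partial>measure_pmf (join_daa D pk sk) \<partial>measure_pmf (setup_daa D \<eta>))"
    unfolding case_prod_beta
    unfolding nn_integral_pmf_cmult[symmetric] by (intro nn_integral_mono worst)
  ultimately show ?thesis by (rule order_trans[rotated])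
qed

text \<open>Both sides are integrals over the product \<open>pair_pmf\<close>, up to swapping
  components, so no measurability condition arises.\<close>

lemma nn_integral_pmf_swap:
  fixes f :: "'a \<Rightarrow> 'b \<Rightarrow> ennreal"
  shows "(\<integral>\<^sup>+ x. \<integral>\<^sup>+ y. f x y \<partial>measure_pmf q \<partial>measure_pmf p) =
    (\<integral>\<^sup>+ y. \<integral>\<^sup>+ x. f x y \<partial>measure_pmf p \<partial>measure_pmf q)"
  using nn_integral_pair_pmf'[where f = "\<lambda>(x, y). f x y" and A = p and B = q]
    nn_integral_pair_pmf'[where f = "\<lambda>(y, x). f x y" and A = q and B = p]
  by (simp add: pair_commute_pmf[of q p] case_prod_beta)

lemma user_failure_le:
  assumes "efficient_daa D" and il: "instantly_linkable D"
    and corr: "\<And>sk choice. sk \<in> keyspace D (fst \<rho>) \<Longrightarrow> pmf (correctness_exp D (fst \<rho>) sk choice) True \<ge> 1 - \<mu>"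
  shows "(\<integral>\<^sup>+ (pk, skI). user_failure D h \<rho> pk skI \<partial>measure_pmf (setup_daa D (fst \<rho>))) \<le> 2 * ennreal \<mu>"
proof -
  let ?\<eta> = "fst \<rho>"
  have keys: "set_pmf (ukey_daa D ?\<eta>) \<subseteq> keyspace D ?\<eta>"
    using assms(1) by (simp add: efficient_daa_def)
  \<comment> \<open>Values in the supports of honest generation satisfy \<open>created_with\<close>,
    so the bound holds almost everywhere, which is enough under the integrals.\<close>
  have "comment_failure D h \<rho> pk sk cred \<le> (SUP i. sign_failure D pk sk cred i)"
    if "(pk, skI) \<in> set_pmf (setup_daa D ?\<eta>)" "sk \<in> set_pmf (ukey_daa D ?\<eta>)"
      "com \<in> set_pmf (join_daa D pk sk)" "cred \<in> set_pmf (issue_daa D skI com)" for pk skI sk com cred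
    unfolding sign_failure_def
    by (rule comment_failure_le[OF il]) (use that keys in \<open>unfold created_with_def, blast\<close>)
  then have "(\<integral>\<^sup>+ (pk, skI). user_failure D h \<rho> pk skI \<partial>measure_pmf (setup_daa D ?\<eta>))
    \<le> (\<integral>\<^sup>+ (pk, skI). \<integral>\<^sup>+ sk. \<integral>\<^sup>+ com. \<integral>\<^sup>+ cred. (SUP i. sign_failure D pk sk cred i)
     \<partial>measure_pmf (issue_daa D skI com) \<partial>measure_pmf (join_daa D pk sk) \<partial>measure_pmf (ukey_daa D ?\<eta>)
     \<partial>measure_pmf (setup_daa D ?\<eta>))"
    unfolding user_failure_def case_prod_beta
    by (intro nn_integral_mono_AE AE_pmfI) auto
  \<comment> \<open>Correctness fixes the user key before the issuer keys are drawn; the game does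
    the opposite, but the two draws are independent.\<close>
  also have "\<dots> = (\<integral>\<^sup>+ sk. \<integral>\<^sup>+ (pk, skI). \<integral>\<^sup>+ com. \<integral>\<^sup>+ cred. (SUP i. sign_failure D pk sk cred i)
     \<partial>measure_pmf (issue_daa D skI com) \<partial>measure_pmf (join_daa D pk sk) \<partial>measure_pmf (setup_daa D ?\<eta>)
     \<partial>measure_pmf (ukey_daa D ?\<eta>))"
    unfolding case_prod_beta by (rule nn_integral_pmf_swap)
  also have "\<dots> \<le> (\<integral>\<^sup>+ sk. 2 * ennreal \<mu> \<partial>measure_pmf (ukey_daa D ?\<eta>))"
    using keys by (intro nn_integral_mono_AE AE_pmfI worst_sign_failure_le corr) auto
  finally show ?thesis by simp
qed

section \<open>The experiment\<close>

text \<open>With no step left the potential is at least the indicator of a bad state, and equals it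
  while \<open>n = 0\<close>; initially there are neither users nor comments, so only the quadratic
  term survives.\<close>

lemma run_tm_bad_state_le:
  "(\<integral>\<^sup>+ x. of_bool (bad_state D h \<rho> pk (snd x))
      \<partial>measure_pmf (run_tm A (acccompl_oracle D h Z \<rho> pk (pk, skI)) w init_state))
     \<le> of_nat (run_time A w * run_time A w) * user_failure D h \<rho> pk skI"
proof -
  have "(\<integral>\<^sup>+ x. of_bool (bad_state D h \<rho> pk (snd x))
      \<partial>measure_pmf (run_tm A (acccompl_oracle D h Z \<rho> pk (pk, skI)) w init_state)) =
    (\<integral>\<^sup>+ x. potential D h \<rho> pk skI 0 (snd x) \<partial>measure_pmf (run_steps A
      (acccompl_oracle D h Z \<rho> pk (pk, skI)) (run_time A w) (init_config A w, init_state)))"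
    by (simp add: run_tm_def run_time_def potential_def case_prod_beta)
  also have "\<dots> \<le> potential D h \<rho> pk skI (run_time A w) init_state"
    by (rule order_trans[OF run_steps_potential[where \<Phi> = "potential D h \<rho> pk skI",
          OF oracle_potential potential_mono]]) simp
  also have "\<dots> = of_nat (run_time A w * run_time A w) * user_failure D h \<rho> pk skI"
    by (simp add: potential_def init_state_def bad_state_def worst_failure_def)
  finally show ?thesis .
qed

text \<open>A winning output names a logged comment whose claim fails, so the final state is
  bad.\<close>

lemma exp_acccompl_le_bad_state:
  "ennreal (pmf (exp_acccompl D h Z A \<eta>) True) \<le>
    (\<integral>\<^sup>+ z. \<integral>\<^sup>+ (pk, skI). \<integral>\<^sup>+ x. of_bool (bad_state D h (\<eta>, z) pk (snd x))
      \<partial>measure_pmf (run_tm A (acccompl_oracle D h Z (\<eta>, z) pk (pk, skI)) (enc ((\<eta>, z), pk)) init_state)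
      \<partial>measure_pmf (setup_daa D \<eta>) \<partial>measure_pmf (setup_zk Z \<eta>))"
proof -
  have "ennreal (pmf (exp_acccompl D h Z A \<eta>) True) =
      (\<integral>\<^sup>+ b. of_bool b \<partial>measure_pmf (exp_acccompl D h Z A \<eta>))"
    by (simp add: nn_integral_measure_pmf nn_integral_count_space_finite UNIV_bool)
  also have "\<dots> \<le> (\<integral>\<^sup>+ z. \<integral>\<^sup>+ (pk, skI). \<integral>\<^sup>+ x. of_bool (bad_state D h (\<eta>, z) pk (snd x))
      \<partial>measure_pmf (run_tm A (acccompl_oracle D h Z (\<eta>, z) pk (pk, skI)) (enc ((\<eta>, z), pk)) init_state)
      \<partial>measure_pmf (setup_daa D \<eta>) \<partial>measure_pmf (setup_zk Z \<eta>))"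
    unfolding exp_acccompl_def tt_setup_def tt_keygen_def case_prod_beta
    by (simp only: nn_integral_bind_pmf nn_integral_return_pmf nn_integral_map_pmf fst_conv snd_conv)
      (intro nn_integral_mono, auto simp: claim_fails_def tt_claim_def intro: bad_stateI split: option.splits)
  finally show ?thesis .
qed

lemma adversary_run_time_poly:
  assumes "ppt_tm A" "ppt (setup_daa D)" "ppt (setup_zk Z)"
  obtains p :: "nat poly" where "\<And>\<eta> z pk skI. z \<in> set_pmf (setup_zk Z \<eta>) \<Longrightarrow>
    (pk, skI) \<in> set_pmf (setup_daa D \<eta>) \<Longrightarrow> run_time A (enc ((\<eta>, z), pk)) \<le> poly p \<eta>"
proof -
  obtain pA where A: "\<And>w. run_time A w \<le> poly pA (length w)"
    using run_time_poly[OF assms(1)] by blast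
  obtain pD where D: "\<And>\<eta> y. y \<in> set_pmf (setup_daa D \<eta>) \<Longrightarrow> length (enc y) \<le> poly pD (length (enc \<eta>))"
    using ppt_output_length[OF assms(2)] by blast
  obtain pZ where Z: "\<And>\<eta> y. y \<in> set_pmf (setup_zk Z \<eta>) \<Longrightarrow> length (enc y) \<le> poly pZ (length (enc \<eta>))"
    using ppt_output_length[OF assms(3)] by blast
  \<comment> \<open>The security parameter is written in unary with one terminating bit.\<close>
  have len: "length (enc \<eta>) = poly [:1, 1:] \<eta>" for \<eta> :: nat by (simp add: enc_nat_def)
  have "run_time A (enc ((\<eta>, z), pk)) \<le> poly (pcompose (pcompose pA ([:0, 1:] + pZ + pD)) [:1, 1:]) \<eta>"
    if "z \<in> set_pmf (setup_zk Z \<eta>)" "(pk, skI) \<in> set_pmf (setup_daa D \<eta>)" for \<eta> z pk skI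
  proof -
    \<comment> \<open>The input concatenates three encodings; that of \<open>pk\<close> is a prefix
      of that of \<open>(pk, skI)\<close>, which \<open>pD\<close> bounds.\<close>
    have "length (enc ((\<eta>, z), pk)) \<le> poly ([:0, 1:] + pZ + pD) (length (enc \<eta>))"
      using D[OF that(2)] Z[OF that(1)] by (simp add: enc_prod_def)
    then have "poly pA (length (enc ((\<eta>, z), pk))) \<le> poly pA (poly ([:0, 1:] + pZ + pD) (length (enc \<eta>)))"
      by (rule poly_nat_mono)
    then show ?thesis using A[of "enc ((\<eta>, z), pk)"] unfolding len by (simp only: poly_pcompose)
  qed
  then show ?thesis using that by blast
qed

theorem theorem12:
  fixes D :: ildaa and h :: "nat \<Rightarrow> bits \<Rightarrow> bits" and Z :: join_proof_system
  assumes "efficient_daa D"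
    and "instantly_linkable D"
    and "correct_daa D"
    and "collision_resistant_hash h"
    and "proof_of_knowledge (R_Join D) Z"
  shows "\<forall>A :: tm. ppt_tm A \<longrightarrow> negligible_fun (\<lambda>\<eta>. pmf (exp_acccompl D h Z A \<eta>) True)"
proof (intro allI impI)
  fix A assume A: "ppt_tm A"
  obtain \<mu> where neg: "negligible_fun \<mu>" and
    corr: "\<And>\<eta> sk choice. sk \<in> keyspace D \<eta> \<Longrightarrow> pmf (correctness_exp D \<eta> sk choice) True \<ge> 1 - \<mu> \<eta>"
    using assms(3) by (auto simp: correct_daa_def)
  have "ppt (setup_daa D)" "ppt (setup_zk Z)"
    using assms(1,5) by (auto simp: efficient_daa_def proof_of_knowledge_def)
  then obtain p where p: "\<And>\<eta> z pk skI. z \<in> set_pmf (setup_zk Z \<eta>) \<Longrightarrow>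
    (pk, skI) \<in> set_pmf (setup_daa D \<eta>) \<Longrightarrow> run_time A (enc ((\<eta>, z), pk)) \<le> poly p \<eta>"
    using adversary_run_time_poly[OF A] by blast
  \<comment> \<open>The square of the step bound \<open>p\<close> comes from the potential, the
    factor 2 from the near-attained supremum.\<close>
  have "\<bar>pmf (exp_acccompl D h Z A \<eta>) True\<bar> \<le> real (poly (p * p * [:2:]) \<eta>) * \<bar>\<mu> \<eta>\<bar>" for \<eta>
  proof -
    define C :: ennreal where "C = of_nat (poly (p * p) \<eta>)"
    have "(\<integral>\<^sup>+ x. of_bool (bad_state D h (\<eta>, z) pk (snd x))
        \<partial>measure_pmf (run_tm A (acccompl_oracle D h Z (\<eta>, z) pk (pk, skI)) (enc ((\<eta>, z), pk)) init_state))
        \<le> C * user_failure D h (\<eta>, z) pk skI"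
      if "z \<in> set_pmf (setup_zk Z \<eta>)" "(pk, skI) \<in> set_pmf (setup_daa D \<eta>)" for z pk skI
      unfolding C_def poly_mult
      by (rule order_trans[OF run_tm_bad_state_le])
        (intro mult_right_mono of_nat_mono mult_mono p[OF that]; simp)
    then have "ennreal (pmf (exp_acccompl D h Z A \<eta>) True) \<le>
        (\<integral>\<^sup>+ z. \<integral>\<^sup>+ (pk, skI). C * user_failure D h (\<eta>, z) pk skI
          \<partial>measure_pmf (setup_daa D \<eta>) \<partial>measure_pmf (setup_zk Z \<eta>))"
      by (intro order_trans[OF exp_acccompl_le_bad_state] nn_integral_mono_AE AE_pmfI)
        (auto simp: case_prod_beta)
    \<comment> \<open>The issuer keys are drawn independently of the reference string
      \<open>z\<close>, and the bound is the same for every \<open>z\<close>.\<close>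
    also have "\<dots> \<le> (\<integral>\<^sup>+ z. C * (2 * ennreal (\<mu> \<eta>)) \<partial>measure_pmf (setup_zk Z \<eta>))"
    proof (rule nn_integral_mono)
      fix z
      have "(\<integral>\<^sup>+ (pk, skI). C * user_failure D h (\<eta>, z) pk skI \<partial>measure_pmf (setup_daa D \<eta>)) =
          C * (\<integral>\<^sup>+ (pk, skI). user_failure D h (\<eta>, z) pk skI \<partial>measure_pmf (setup_daa D \<eta>))"
        unfolding case_prod_beta by (rule nn_integral_pmf_cmult)
      also have "\<dots> \<le> C * (2 * ennreal (\<mu> \<eta>))"
        using user_failure_le[OF assms(1,2), where \<rho> = "(\<eta>, z)" and \<mu> = "\<mu> \<eta>" and h = h] corr
        by (intro mult_left_mono) auto
      finally show "(\<integral>\<^sup>+ (pk, skI). C * user_failure D h (\<eta>, z) pk skI \<partial>measure_pmf (setup_daa D \<eta>))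
        \<le> C * (2 * ennreal (\<mu> \<eta>))" .
    qed
    also have "\<dots> = C * (2 * ennreal (\<mu> \<eta>))" by simp
    \<comment> \<open>\<open>\<mu>\<close> may take negative values; the absolute value makes the
      product rule for \<open>ennreal\<close> applicable.\<close>
    also have "\<dots> \<le> C * (2 * ennreal \<bar>\<mu> \<eta>\<bar>)"
      by (auto intro!: mult_left_mono ennreal_leI)
    also have "\<dots> = ennreal (real (poly (p * p * [:2:]) \<eta>) * \<bar>\<mu> \<eta>\<bar>)"
      by (simp add: C_def ennreal_mult ennreal_of_nat_eq_real_of_nat mult_ac)
    finally show ?thesis by simp
  qed
  then show "negligible_fun (\<lambda>\<eta>. pmf (exp_acccompl D h Z A \<eta>) True)"
    by (rule negligible_fun_poly_mult[OF neg])
qed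

end
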